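(* For real $u\ge4$, with $y=1/(u-2)$, $$P_4(u)=P_3(u-1)\log(u)+\frac{\zeta_2}{4}\left(2\,\mathrm{Li}_2\!\left(1-\frac1u\right)+\log^2(u)\right)-E_4(y)-H_4(y).$$
   Context: The functions $P_k$ are defined by $P_0(u)=1$ for $u\ge 0$, and for integers $k\ge1$, $P_k:[k,\infty)\to\mathbb{R}$ is the function with $P_k(k)=0$ and $uP_k'(u)=P_{k-1}(u-1)$ for $u\ge k$. $\mathrm{Li}_k(z)=\sum_{n\ge1}z^n/n^k$ for $|z|\le1$, so $\mathrm{Li}_1(z)=-\log(1-z)$, and $\zeta_k=\mathrm{Li}_k(1)$. For $0<y\le\frac12$ define $$E_4(y)=\tfrac{19}{16}\zeta_4-3\,\mathrm{Li}_4(-y)+3\,\mathrm{Li}_3(-y)\log(y)-\tfrac32\,\mathrm{Li}_2(-y)\log^2(y)+\tfrac12\,\mathrm{Li}_1(-y)\log^3(y)+\tfrac18\log^4(y),$$ $$H_4(y)=\int_0^y\left(\log\!\left(\frac{x}{1+2x}\right)\mathrm{Li}_2(x)+\frac12\log^2(x)\,\mathrm{Li}_1(-2x)\right)\frac{dx}{x(1+x)}.$$ *)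

theory Defs
  imports "HOL-Analysis.Analysis"
begin

definition Li :: "nat \<Rightarrow> real \<Rightarrow> real" where
  "Li k z = (\<Sum>n. z ^ (n + 1) / real (n + 1) ^ k)"

definition zeta_val :: "nat \<Rightarrow> real" where
  "zeta_val k = Li k 1"

text \<open>P_0(u) = 1 for u >= 0; P_k is the function on [k,oo) with P_k(k) = 0 and
  u P_k'(u) = P_{k-1}(u-1) for u >= k (one-sided derivative at the endpoint).
  Outside its domain P_k is set to 0 (an arbitrary normalisation).\<close>
primrec P :: "nat \<Rightarrow> real \<Rightarrow> real" where
  "P 0 = (\<lambda>u. if u \<ge> 0 then 1 else 0)"
| "P (Suc k) = (THE f. f (real (Suc k)) = 0 \<and>
      (\<forall>u \<ge> real (Suc k). \<exists>D. (f has_real_derivative D) (at u within {real (Suc k)..})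
                                 \<and> u * D = P k (u - 1)) \<and>
      (\<forall>u < real (Suc k). f u = 0))"

definition E4 :: "real \<Rightarrow> real" where
  "E4 y = 19 / 16 * zeta_val 4 - 3 * Li 4 (- y) + 3 * Li 3 (- y) * ln y
          - 3 / 2 * Li 2 (- y) * (ln y) ^ 2 + 1 / 2 * Li 1 (- y) * (ln y) ^ 3
          + 1 / 8 * (ln y) ^ 4"

definition H4 :: "real \<Rightarrow> real" where
  "H4 y = integral {0..y}
     (\<lambda>x. (ln (x / (1 + 2 * x)) * Li 2 x + 1 / 2 * (ln x) ^ 2 * Li 1 (- 2 * x))
          / (x * (1 + x)))"

end

theory Submission
  imports Defs "HOL-Real_Asymp.Real_Asymp"
begin

text \<open>
  Both sides of the identity have the same derivative in \<open>u\<close>: this is a direct computation from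
  \<open>P\<^sub>2(v) = log\<^sup>2(v)/2 + Li\<^sub>2(1/v) - \<zeta>\<^sub>2/2\<close>, so they differ by a constant \<open>K\<close>, and the point is to
  show \<open>K = 0\<close> by letting \<open>u \<rightarrow> \<infinity>\<close>. With \<open>L = log u\<close>, the right-hand side gives
  \<open>P\<^sub>4(u) = L\<^sup>4/24 - \<zeta>\<^sub>2 L\<^sup>2/4 + c L + (\<zeta>\<^sub>2\<^sup>2/2 - 19 \<zeta>\<^sub>4/16 + K) + o(1)\<close> for some \<open>c\<close>.
  On the other hand, the differential equation turns into a recursion for the Laplace transforms
  \<open>\<Lambda>\<^sub>k(s) = s \<integral> exp(-su) P\<^sub>k(u) du\<close>, namely \<open>\<Lambda>\<^sub>k\<^sub>+\<^sub>1(s) = \<integral>\<^sub>s\<^sup>\<infinity> exp(-r)/r \<Lambda>\<^sub>k(r) dr\<close>. Hence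
  \<open>\<Lambda>\<^sub>4 = E\<^sup>4/24\<close> with \<open>E\<close> the exponential integral, and \<open>E(s) = - log s - \<gamma> + o(1)\<close> as \<open>s \<rightarrow> 0\<close>.
  Integrating the asymptotic expansion of \<open>P\<^sub>4(t/s)\<close> against \<open>exp(-t) dt\<close> and comparing determines
  the constant term through the moments of \<open>log t + \<gamma>\<close>, which are the Taylor coefficients of
  \<open>\<Gamma>(1 + x) exp(\<gamma> x)\<close> and so are polynomials in zeta values. Finally \<open>\<zeta>\<^sub>4 = 2 \<zeta>\<^sub>2\<^sup>2/5\<close> follows
  by comparing coefficients in the reflection formula, and \<open>K = 0\<close> results.
\<close>

section \<open>The functions \<open>P\<^sub>k\<close>\<close>

lemma has_real_derivative_primitive:
  fixes g :: "real \<Rightarrow> real"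
  assumes g: "continuous_on {a..} g" and u: "u \<ge> a"
  shows "((\<lambda>u. integral {a..u} g) has_real_derivative g u) (at u within {a..})"
proof -
  have "((\<lambda>u. integral {a..u} g) has_real_derivative g u) (at u within {a..u+1})"
    using u by (intro integral_has_real_derivative continuous_on_subset[OF g]) auto
  also have "at u within {a..u+1} = at u within {a..}"
    by (rule at_within_nhd[of _ "{..<u+1}"]) auto
  finally show ?thesis .
qed

lemma eq_on_atLeast_if_same_derivative:
  fixes f h :: "real \<Rightarrow> real"
  assumes "\<And>u. u \<ge> a \<Longrightarrow> (f has_real_derivative d u) (at u within {a..})"
    and "\<And>u. u \<ge> a \<Longrightarrow> (h has_real_derivative d u) (at u within {a..})"
    and "f a = h a" "u \<ge> a"
  shows "f u = h u"
proof -
  have "((\<lambda>u. f u - h u) has_real_derivative 0) (at u within {a..})" if "u \<in> {a..}" for u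
    using DERIV_diff[OF assms(1)[of u] assms(2)[of u]] that by auto
  then have "\<exists>c. \<forall>u\<in>{a..}. f u - h u = c"
    by (intro has_field_derivative_zero_constant) auto
  then obtain c where c: "\<And>u. u \<ge> a \<Longrightarrow> f u - h u = c" by auto
  from c[of a] c[of u] assms(3,4) show ?thesis by simp
qed

text \<open>The fundamental theorem of calculus gives existence for the definite description, and a
  primitive with prescribed initial value is unique. Continuity of \<open>P k\<close> is a
  hypothesis because it is itself obtained from this lemma, by induction.\<close>

lemma P_Suc_primitive:
  assumes "continuous_on {real k..} (P k)"
  shows "P (Suc k) = (\<lambda>u. integral {real (Suc k)..u} (\<lambda>u. P k (u - 1) / u))"
proof -
  let ?a = "real (Suc k)" and ?g = "\<lambda>u. P k (u - 1) / u"
  let ?F = "\<lambda>u. integral {?a..u} ?g"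
  have "continuous_on {?a..} (\<lambda>u. P k (u - 1))"
    by (intro continuous_on_compose2[OF assms] continuous_intros) auto
  then have g: "continuous_on {?a..} ?g"
    by (intro continuous_intros) auto
  note F = has_real_derivative_primitive[OF g]
  show ?thesis unfolding P.simps
  proof (rule the_equality, goal_cases)
    case 1
    have "u * ?g u = P k (u - 1)" if "u \<ge> ?a" for u
      using that by auto
    then show ?case using F by fastforce
  next
    case (2 f)
    have f: "(f has_real_derivative ?g u) (at u within {?a..})" if u: "u \<ge> ?a" for u
    proof -
      from 2 u obtain D where D: "(f has_real_derivative D) (at u within {?a..})" "u * D = P k (u - 1)"
        by blast
      have "D = ?g u" using u D(2) by (auto simp: field_simps)
      with D(1) show ?thesis by simp
    qed
    show ?case
    proof
      fix u
      \<comment> \<open>Below \<open>Suc k\<close> both sides are 0: \<open>f\<close> by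
        normalisation, the integral because its interval is empty.\<close>
      show "f u = ?F u"
        using eq_on_atLeast_if_same_derivative[OF f F, of u] 2 by (cases "u \<ge> ?a") auto
    qed
  qed
qed

text \<open>A primitive is differentiable within its half-line, hence continuous; this discharges
  the hypothesis of \<open>P_Suc_primitive\<close> for every \<open>k\<close>.\<close>

lemma continuous_on_P: "continuous_on {real k..} (P k)"
proof (induction k)
  case 0
  have "continuous_on {0::real..} (\<lambda>_. 1::real)" by simp
  then have "continuous_on {0::real..} (P 0)" by (rule continuous_on_eq) auto
  then show ?case by simp
next
  case (Suc k)
  let ?g = "\<lambda>u. P k (u - 1) / u"
  have "continuous_on {real (Suc k)..} (\<lambda>u. P k (u - 1))"
    by (intro continuous_on_compose2[OF Suc] continuous_intros) auto
  then have g: "continuous_on {real (Suc k)..} ?g"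
    by (intro continuous_intros) auto
  show ?case unfolding P_Suc_primitive[OF Suc] continuous_on_eq_continuous_within
    using DERIV_continuous[OF has_real_derivative_primitive[OF g]] by blast
qed

lemma continuous_on_P_shift: "continuous_on {real (Suc k)..} (\<lambda>u. P k (u - 1) / u)"
proof -
  have "continuous_on {real (Suc k)..} (\<lambda>u. P k (u - 1))"
    by (intro continuous_on_compose2[OF continuous_on_P] continuous_intros) auto
  then show ?thesis by (intro continuous_intros) auto
qed

lemmas P_Suc_eq = P_Suc_primitive[OF continuous_on_P]

lemma has_real_derivative_P_within:
  "u \<ge> real (Suc k) \<Longrightarrow> (P (Suc k) has_real_derivative P k (u - 1) / u) (at u within {real (Suc k)..})"
  unfolding P_Suc_eq by (rule has_real_derivative_primitive[OF continuous_on_P_shift])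

lemma has_real_derivative_P:
  assumes "u > real (Suc k)"
  shows "(P (Suc k) has_real_derivative P k (u - 1) / u) (at u)"
proof -
  have "at u within {real (Suc k)..} = at u"
    using assms by (intro at_within_interior) auto
  with has_real_derivative_P_within[of k u] assms show ?thesis by simp
qed

lemma P_eq_0: "u < real k \<Longrightarrow> P k u = 0"
  by (cases k) (auto simp: P_Suc_eq simp del: P.simps(2))

lemma P_self_eq_0: "P (Suc k) (real (Suc k)) = 0"
  by (simp add: P_Suc_eq del: P.simps(2))

text \<open>The criterion by which the closed forms of \<open>P 1\<close> and \<open>P 2\<close> are
  verified.\<close>

lemma P_Suc_eqI:
  assumes "\<And>u. u \<ge> real (Suc k) \<Longrightarrow> (f has_real_derivative P k (u - 1) / u) (at u within {real (Suc k)..})"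
    and "f (real (Suc k)) = 0" and "u \<ge> real (Suc k)"
  shows "P (Suc k) u = f u"
  using assms(2) P_self_eq_0[of k]
  by (intro eq_on_atLeast_if_same_derivative[OF has_real_derivative_P_within assms(1) _ assms(3)]) auto

lemma P_nonneg: "P k u \<ge> 0"
proof (induction k arbitrary: u)
  case (Suc k)
  show ?case unfolding P_Suc_eq
    by (intro Henstock_Kurzweil_Integration.integral_nonneg integrable_continuous_real
        continuous_on_subset[OF continuous_on_P_shift] divide_nonneg_nonneg Suc) auto
qed auto

text \<open>\<open>P 0\<close> jumps at 0, so measurability rests on continuity on the closed
  half-line together with vanishing below it.\<close>

lemma borel_measurable_P [measurable]: "P k \<in> borel_measurable borel"
proof -
  have "(\<lambda>u. if u \<in> {real k..} then P k u else 0) \<in> borel_measurable borel"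
    by (intro borel_measurable_continuous_on_if continuous_on_P) auto
  also have "(\<lambda>u. if u \<in> {real k..} then P k u else 0) = P k"
    by (auto simp: P_eq_0)
  finally show ?thesis .
qed

lemma P_1: "u \<ge> 1 \<Longrightarrow> P 1 u = ln u"
  unfolding One_nat_def by (rule P_Suc_eqI) (auto intro!: derivative_eq_intros)

section \<open>Polylogarithms\<close>

lemma Li_conv_powser: "Li k z = (\<Sum>n. (1 / real (n + 1) ^ k) * z ^ Suc n)"
  by (simp add: Li_def)

lemma summable_bounded_coeff_powser:
  fixes z :: real
  assumes "\<bar>z\<bar> < 1" "\<And>n. \<bar>c n\<bar> \<le> (1::real)"
  shows "summable (\<lambda>n. c n * z ^ n)"
proof (rule summable_comparison_test')
  show "summable (\<lambda>n. \<bar>z\<bar> ^ n)" using assms by (intro summable_geometric) auto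
  show "norm (c n * z ^ n) \<le> \<bar>z\<bar> ^ n" for n
    using assms(2)[of n] by (auto simp: abs_mult power_abs mult_left_le_one_le)
qed

lemma inverse_Suc_power_le_1: "\<bar>1 / real (n + 1) ^ k\<bar> \<le> 1"
  by (simp add: one_le_power)

lemma summable_Li:
  fixes z :: real
  assumes "\<bar>z\<bar> < 1"
  shows "summable (\<lambda>n. 1 / real (n + 1) ^ k * z ^ Suc n)"
  using summable_mult[OF summable_bounded_coeff_powser[OF assms inverse_Suc_power_le_1[of _ k]], of z]
  by (simp add: mult_ac)

text \<open>Termwise differentiation: the factor \<open>n + 1\<close> lowers the exponent in the
  denominator by one.\<close>

lemma has_real_derivative_Li:
  assumes "\<bar>z\<bar> < 1" "z \<noteq> 0"
  shows "(Li (Suc k) has_real_derivative Li k z / z) (at z)"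
proof -
  let ?f = "\<lambda>n. 1 / real (n + 1) ^ Suc k"
  have "((\<lambda>z. \<Sum>n. ?f n * z ^ Suc n) has_real_derivative (\<Sum>n. ?f n * real (Suc n) * z ^ n)) (at z)"
  proof (rule DERIV_power_series')
    show "z \<in> {-1<..<1}" using assms by auto
    fix x :: real assume "x \<in> {-1<..<1}"
    then have x: "\<bar>x\<bar> < 1" by auto
    have "summable (\<lambda>n. 1 / real (n + 1) ^ k * x ^ n)"
      by (rule summable_bounded_coeff_powser[OF x inverse_Suc_power_le_1])
    then show "summable (\<lambda>n. ?f n * real (Suc n) * x ^ n)"
      by simp
  qed auto
  moreover have "(\<Sum>n. ?f n * real (Suc n) * z ^ n) = Li k z / z"
  proof -
    have "z * (\<Sum>n. 1 / real (n + 1) ^ k * z ^ n) = (\<Sum>n. z * (1 / real (n + 1) ^ k * z ^ n))"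
      by (rule suminf_mult[symmetric, OF summable_bounded_coeff_powser[OF assms(1) inverse_Suc_power_le_1]])
    then show ?thesis using assms
      by (simp add: Li_def mult_ac eq_divide_eq)
  qed
  ultimately show ?thesis by (simp add: Li_conv_powser[abs_def])
qed

lemma has_real_derivative_Li_compose [derivative_intros]:
  assumes "(g has_real_derivative g') (at x within S)" "\<bar>g x\<bar> < 1" "g x \<noteq> 0" "k > 0"
  shows "((\<lambda>x. Li k (g x)) has_real_derivative Li (k - 1) (g x) / g x * g') (at x within S)"
  using DERIV_chain2[OF has_real_derivative_Li[of "g x" "k - 1"] assms(1)] assms by simp

lemma Li_1: "\<bar>z\<bar> < 1 \<Longrightarrow> Li 1 z = - ln (1 - z)"
proof -
  assume z: "\<bar>z\<bar> < 1"
  have eq: "(-1) ^ n * (1 / real (n + 1)) * (1 - z - 1) ^ Suc n = - (z ^ (n + 1) / real (n + 1) ^ 1)" for n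
  proof -
    have "(-1) ^ n * (- z) ^ Suc n = - (z ^ Suc n)" by (induction n) auto
    then show ?thesis by (simp add: field_simps)
  qed
  have "ln (1 - z) = (\<Sum>n. - (z ^ (n + 1) / real (n + 1) ^ 1))"
    using z by (subst ln_series) (auto simp only: eq)
  also have "\<dots> = - Li 1 z"
    unfolding Li_def using summable_Li[OF z, of 1] by (subst suminf_minus) auto
  finally show ?thesis by simp
qed

text \<open>Coefficients of absolute value at most 1 give the geometric majorant |z|/(1 - |z|),
  whose denominator is at least 1/2. The bound is uniform in \<open>k\<close>.\<close>

lemma abs_Li_le:
  assumes "\<bar>z\<bar> \<le> 1/2"
  shows "\<bar>Li k z\<bar> \<le> 2 * \<bar>z\<bar>"
proof -
  have z: "\<bar>z\<bar> < 1" using assms by auto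
  have geo: "(\<lambda>n. \<bar>z\<bar> * \<bar>z\<bar> ^ n) sums (\<bar>z\<bar> * (1 / (1 - \<bar>z\<bar>)))"
    using z by (intro sums_mult geometric_sums) auto
  have le: "norm (1 / real (n + 1) ^ k * z ^ Suc n) \<le> \<bar>z\<bar> * \<bar>z\<bar> ^ n" for n
    using mult_right_mono[OF inverse_Suc_power_le_1[of n k], of "\<bar>z\<bar> * \<bar>z\<bar> ^ n"]
    by (simp add: abs_mult power_abs)
  have "\<bar>Li k z\<bar> \<le> (\<Sum>n. \<bar>z\<bar> * \<bar>z\<bar> ^ n)"
    unfolding Li_conv_powser real_norm_def[symmetric, of "suminf _"]
    by (rule norm_suminf_le[OF le]) (use geo in \<open>auto simp: sums_iff\<close>)
  also have "\<dots> = \<bar>z\<bar> * (1 / (1 - \<bar>z\<bar>))" using geo by (simp add: sums_iff)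
  also have "\<dots> \<le> \<bar>z\<bar> * 2" using assms by (intro mult_left_mono) (auto simp: field_simps)
  finally show ?thesis by simp
qed

text \<open>Weierstrass M-test: for exponents at least 2 the majorant converges up to the boundary,
  which makes the value at 1 accessible as a limit.\<close>

lemma continuous_on_Li:
  assumes "k \<ge> 2"
  shows "continuous_on {-1..1} (Li k)"
proof -
  have sum: "summable (\<lambda>n. inverse (real (n + 1) ^ k))"
    using inverse_power_summable[OF assms, where ?'a = real] by (subst summable_iff_shift) auto
  have "uniform_limit {-1..1} (\<lambda>n z. \<Sum>i<n. z ^ (i + 1) / real (i + 1) ^ k) (Li k) sequentially"
    unfolding Li_def[abs_def]
  proof (rule Weierstrass_m_test[OF _ sum])
    fix n and z :: real assume "z \<in> {-1..1}"
    then have "\<bar>z\<bar> ^ (n + 1) \<le> 1" by (intro power_le_one) auto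
    then show "norm (z ^ (n + 1) / real (n + 1) ^ k) \<le> inverse (real (n + 1) ^ k)"
      by (simp add: power_abs divide_simps del: power_Suc)
  qed
  then show ?thesis
    by (rule uniform_limit_theorem[rotated]) (auto intro!: always_eventually continuous_intros)
qed

lemma Li_0 [simp]: "Li k 0 = 0"
  by (simp add: Li_def)

text \<open>Euler's reflection formula. The derivative of the left-hand side vanishes because
  Li_1(x) = -log(1-x), and the constant is its limit as x tends to 0 from the right.\<close>

lemma Li_2_reflection:
  assumes "0 < x" "x < 1"
  shows "Li 2 x + Li 2 (1 - x) + ln x * ln (1 - x) = zeta_val 2"
proof -
  let ?f = "\<lambda>x. Li 2 x + Li 2 (1 - x) + ln x * ln (1 - x)"
  have "(?f has_real_derivative 0) (at x within {0<..<1})" if x: "x \<in> {0<..<1}" for x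
  proof -
    have "(?f has_real_derivative Li 1 x / x - Li 1 (1 - x) / (1 - x) + (ln (1 - x) / x - ln x / (1 - x))) (at x)"
      using x by (auto intro!: derivative_eq_intros)
    also have "Li 1 x / x - Li 1 (1 - x) / (1 - x) + (ln (1 - x) / x - ln x / (1 - x)) = 0"
      using x by (simp add: Li_1 del: One_nat_def)
    finally show ?thesis by (rule has_field_derivative_at_within)
  qed
  then have "\<exists>c. \<forall>x\<in>{0<..<1}. ?f x = c"
    by (intro has_field_derivative_zero_constant) auto
  then obtain c where c: "\<And>x. x \<in> {0<..<1} \<Longrightarrow> ?f x = c" by blast
  have lim: "(Li 2 \<longlongrightarrow> Li 2 z) (at z within {-1..1})" if "z \<in> {-1..1}" for z
    using continuous_on_Li[of 2] that by (auto simp: continuous_on_def)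
  have ev: "eventually (\<lambda>x::real. x \<in> {0<..<1}) (at_right 0)"
    using eventually_at_right_real[of 0 1] by simp
  have "((\<lambda>x. Li 2 x) \<longlongrightarrow> Li 2 0) (at_right 0)"
  proof (rule filterlim_compose[OF lim])
    show "filterlim (\<lambda>x::real. x) (at 0 within {-1..1}) (at_right 0)"
      unfolding filterlim_at by (auto intro!: tendsto_eq_intros eventually_mono[OF ev])
  qed auto
  moreover have "((\<lambda>x. Li 2 (1 - x)) \<longlongrightarrow> Li 2 1) (at_right 0)"
  proof (rule filterlim_compose[OF lim])
    show "filterlim (\<lambda>x::real. 1 - x) (at 1 within {-1..1}) (at_right 0)"
      unfolding filterlim_at by (auto intro!: tendsto_eq_intros eventually_mono[OF ev])
  qed auto
  moreover have "((\<lambda>x::real. ln x * ln (1 - x)) \<longlongrightarrow> 0) (at_right 0)" by real_asymp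
  ultimately have "(?f \<longlongrightarrow> Li 2 0 + Li 2 1 + 0) (at_right 0)"
    by (intro tendsto_add)
  moreover have "(?f \<longlongrightarrow> c) (at_right 0)"
    by (rule tendsto_eventually) (auto intro!: eventually_mono[OF ev] c)
  ultimately have "c = zeta_val 2"
    by (simp add: zeta_val_def tendsto_unique[OF trivial_limit_at_right_real])
  with c[of x] assms show ?thesis by simp
qed

lemma P_2:
  assumes "u \<ge> 2"
  shows "P 2 u = (ln u)\<^sup>2 / 2 + Li 2 (1 / u) - zeta_val 2 / 2"
proof -
  let ?f = "\<lambda>u. (ln u)\<^sup>2 / 2 + Li 2 (1 / u) - zeta_val 2 / 2"
  have "P (Suc 1) u = ?f u"
  proof (rule P_Suc_eqI)
    fix u assume u: "u \<ge> real (Suc 1)"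
    have "(?f has_real_derivative ln u / u + Li 1 (1 / u) / (1 / u) * (- 1 / u\<^sup>2)) (at u)"
      using u by (auto intro!: derivative_eq_intros simp: power2_eq_square)
    also have "Li 1 (1 / u) = ln u - ln (u - 1)"
    proof -
      have "Li 1 (1 / u) = - ln ((u - 1) / u)" using u by (simp add: Li_1 diff_divide_distrib del: One_nat_def)
      then show ?thesis using u by (simp add: ln_div)
    qed
    also have "ln u / u + (ln u - ln (u - 1)) / (1 / u) * (- 1 / u\<^sup>2) = ln (u - 1) / u"
      using u by (simp add: field_simps power2_eq_square)
    finally show "(?f has_real_derivative P 1 (u - 1) / u) (at u within {real (Suc 1)..})"
      using u by (auto simp: P_1[of "u - 1"] intro: has_field_derivative_at_within simp del: P.simps One_nat_def)
  next
    \<comment> \<open>The reflection formula at 1/2 reads 2 Li_2(1/2) + log(2)^2 = zeta_2, which is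
      the initial condition at u = 2.\<close>
    show "?f (real (Suc 1)) = 0"
      using Li_2_reflection[of "1/2"] by (simp add: ln_div power2_eq_square)
  qed (use assms in auto)
  then show ?thesis by (simp only: numeral_2_eq_2 One_nat_def)
qed

section \<open>Laplace transforms\<close>

text \<open>The function 2 C u^(-1/2) is the tail integral of the bound C u^(-3/2). Subtracting it
  from \<open>f\<close> gives an increasing function, adding it a decreasing one, and the limit
  \<open>c\<close> is squeezed between the two.\<close>

lemma limit_of_bounded_derivative:
  fixes f :: "real \<Rightarrow> real"
  assumes f: "\<And>u. u \<ge> a \<Longrightarrow> (f has_real_derivative d u) (at u)"
    and d: "\<And>u. u \<ge> a \<Longrightarrow> \<bar>d u\<bar> \<le> C * u powr (-3/2)" and a: "a > 0"
  obtains c where "\<And>u. u \<ge> a \<Longrightarrow> \<bar>f u - c\<bar> \<le> 2 * C * u powr (-1/2)"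
proof -
  let ?g = "\<lambda>u. f u - 2 * C * u powr (-1/2)" and ?h = "\<lambda>u. f u + 2 * C * u powr (-1/2)"
  have C: "C \<ge> 0"
  proof -
    have "0 \<le> C * a powr (-3/2)" using d[of a] by linarith
    then show ?thesis using a by (simp add: zero_le_mult_iff)
  qed
  have g: "?g x \<le> ?g y" if "a \<le> x" "x \<le> y" for x y
  proof (rule DERIV_nonneg_imp_nondecreasing[OF that(2)])
    fix u assume "x \<le> u" "u \<le> y"
    with that have u: "a \<le> u" by simp
    have "(?g has_real_derivative d u + C * u powr (-3/2)) (at u)"
      using u a by (auto intro!: derivative_eq_intros f)
    then show "\<exists>y. (?g has_real_derivative y) (at u) \<and> 0 \<le> y"
      using d[OF u] by (intro exI[of _ "d u + C * u powr (-3/2)"]) auto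
  qed
  have h: "?h y \<le> ?h x" if "a \<le> x" "x \<le> y" for x y
  proof (rule DERIV_nonpos_imp_nonincreasing[OF that(2)])
    fix u assume "x \<le> u" "u \<le> y"
    with that have u: "a \<le> u" by simp
    have "(?h has_real_derivative d u - C * u powr (-3/2)) (at u)"
      using u a by (auto intro!: derivative_eq_intros f)
    then show "\<exists>y. (?h has_real_derivative y) (at u) \<and> y \<le> 0"
      using d[OF u] by (intro exI[of _ "d u - C * u powr (-3/2)"]) auto
  qed
  have gh: "?g x \<le> ?h y" if "a \<le> x" "a \<le> y" for x y
  proof -
    have "?g x \<le> ?g (max x y)" using that by (intro g) auto
    also have "\<dots> \<le> ?h (max x y)" using C by simp
    also have "\<dots> \<le> ?h y" using that by (intro h) auto
    finally show ?thesis .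
  qed
  define c where "c = Sup (?g ` {a..})"
  have "?g u \<le> c" if "u \<ge> a" for u
    unfolding c_def using that gh[of _ a] by (intro cSup_upper bdd_aboveI2[of _ _ "?h a"]) auto
  moreover have "c \<le> ?h u" if "u \<ge> a" for u
    unfolding c_def using that gh[of _ u] by (intro cSup_least) auto
  ultimately show ?thesis
    by (intro that[of c]) (force simp: abs_le_iff)
qed

text \<open>\<open>E\<close> is c - F, where F is any primitive of exp(-x)/x on the positive axis
  and c its limit at infinity. Only these two properties of \<open>E\<close> are used later.\<close>

lemma exponential_integral_exists:
  obtains E :: "real \<Rightarrow> real"
  where "\<And>s. s > 0 \<Longrightarrow> (E has_real_derivative - (exp (- s) / s)) (at s)"
    and "(E \<longlongrightarrow> 0) at_top"
proof -
  have "\<exists>F. \<forall>x::real. (0::ereal) < x \<longrightarrow> x < \<infinity> \<longrightarrow> (F has_vector_derivative exp (- x) / x) (at x)"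
    by (rule einterval_antiderivative) (auto intro!: continuous_intros)
  then obtain F where F: "\<And>x::real. x > 0 \<Longrightarrow> (F has_real_derivative exp (- x) / x) (at x)"
    by (auto simp: has_real_derivative_iff_has_vector_derivative)
  \<comment> \<open>Since sqrt(u) <= u <= exp(u) for u >= 1, the integrand is at most
    u^(-3/2).\<close>
  have bound: "\<bar>exp (- u) / u\<bar> \<le> 1 * u powr (-3/2)" if "u \<ge> 1" for u :: real
  proof -
    have "u powr (1/2) \<le> u powr 1" using that by (intro powr_mono) auto
    also have "\<dots> \<le> exp u" using exp_ge_add_one_self[of u] that by (subst powr_one) linarith+
    finally have "u powr (1/2) \<le> exp u" .
    moreover have "u powr (-3/2) = 1 / (u powr (1/2) * u)"
      using that powr_add[of u "1/2" 1] powr_minus[of u "3/2"] by (simp add: field_simps)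
    moreover have "\<bar>exp (- u) / u\<bar> = 1 / (exp u * u)"
      using that by (simp add: exp_minus field_simps)
    ultimately show ?thesis
      using that by (auto intro!: frac_le mult_right_mono)
  qed
  obtain c where c: "\<And>u. u \<ge> 1 \<Longrightarrow> \<bar>F u - c\<bar> \<le> 2 * 1 * u powr (-1/2)"
    by (rule limit_of_bounded_derivative[OF F bound]) auto
  have "((\<lambda>u. c - F u) \<longlongrightarrow> 0) at_top"
  proof (rule Lim_null_comparison)
    show "\<forall>\<^sub>F u in at_top. norm (c - F u) \<le> 2 * 1 * u powr (-1/2)"
      using eventually_ge_at_top[of 1] by eventually_elim (use c in \<open>simp add: abs_minus_commute\<close>)
    show "((\<lambda>u::real. 2 * 1 * u powr (-1/2)) \<longlongrightarrow> 0) at_top" by real_asymp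
  qed
  moreover have "((\<lambda>u. c - F u) has_real_derivative - (exp (- s) / s)) (at s)" if "s > 0" for s
    using that by (auto intro!: derivative_eq_intros F)
  ultimately show ?thesis using that by blast
qed

lemma exponential_integral_nonneg:
  fixes E :: "real \<Rightarrow> real"
  assumes E: "\<And>s. s > 0 \<Longrightarrow> (E has_real_derivative - (exp (- s) / s)) (at s)"
    and lim: "(E \<longlongrightarrow> 0) at_top" and x: "x > 0"
  shows "0 \<le> E x"
proof (rule tendsto_upperbound[OF lim])
  show "\<forall>\<^sub>F y in at_top. E y \<le> E x"
    using eventually_ge_at_top[of x]
  proof eventually_elim
    case (elim y)
    show ?case
    proof (rule DERIV_nonpos_imp_nonincreasing[OF elim])
      fix u assume "x \<le> u"
      with x show "\<exists>d. (E has_real_derivative d) (at u) \<and> d \<le> 0"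
        by (intro exI[of _ "- (exp (- u) / u)"]) (auto intro!: E)
    qed
  qed
qed auto

section \<open>The Laplace recursion for \<open>P k\<close>\<close>

lemma nn_integral_exp_atLeast:
  assumes "a > 0"
  shows "(\<integral>\<^sup>+r. ennreal (exp (- a * r)) * indicator {s..} r \<partial>lborel) = ennreal (exp (- a * s) / a)"
proof -
  have "(\<integral>\<^sup>+r. ennreal (exp (- a * r)) * indicator {s..} r \<partial>lborel) = ennreal (0 - (- exp (- a * s) / a))"
  proof (rule nn_integral_FTC_atLeast)
    show "((\<lambda>r. - exp (- a * r) / a) \<longlongrightarrow> 0) at_top" using assms by real_asymp
    show "((\<lambda>r. - exp (- a * r) / a) has_real_derivative exp (- a * x)) (at x)" for x
      using assms by (auto intro!: derivative_eq_intros)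
  qed auto
  then show ?thesis by simp
qed

lemma P_Suc_eq_nn_integral:
  "ennreal (P (Suc k) w) = (\<integral>\<^sup>+v. ennreal (P k (v - 1) / v) * indicator {v..} w \<partial>lborel)"
proof -
  \<comment> \<open>For negative v the numerator is 0, so the sign of the denominator is
    harmless.\<close>
  have nn: "0 \<le> P k (v - 1) / v" for v
    using P_nonneg[of k "v - 1"] P_eq_0[of "v - 1" k] by (cases "v < 0") auto
  have "((\<lambda>v. P k (v - 1) / v) has_integral P (Suc k) w) {real (Suc k)..w}"
    unfolding P_Suc_eq
    by (intro integrable_integral integrable_continuous_real continuous_on_subset[OF continuous_on_P_shift]) auto
  from nn_integral_has_integral_lebesgue[OF nn this]
  have "ennreal (P (Suc k) w) = (\<integral>\<^sup>+v. ennreal (indicator {real (Suc k)..w} v * (P k (v - 1) / v)) \<partial>lborel)"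
    by simp
  also have "\<dots> = (\<integral>\<^sup>+v. ennreal (P k (v - 1) / v) * indicator {v..} w \<partial>lborel)"
    by (intro nn_integral_cong) (auto simp: indicator_def P_eq_0)
  finally show ?thesis .
qed

text \<open>Tonelli's theorem is applied twice. Integrating over w first leaves the integral of
  P_k(v-1)/v exp(-sv); after the shift v = 1 + u the factor exp(-s(1+u))/(1+u) is itself the
  integral of exp(-(1+u)r) over r >= s, and a second exchange brings out exp(-r)/r times the
  transform of \<open>P k\<close> at r.\<close>

lemma nn_integral_P_Suc_exp:
  assumes s: "s > 0"
  shows "(\<integral>\<^sup>+u. ennreal (s * exp (- s * u) * P (Suc k) u) \<partial>lborel)
       = (\<integral>\<^sup>+r. ennreal (exp (- r) / r) * (\<integral>\<^sup>+u. ennreal (r * exp (- r * u) * P k u) \<partial>lborel) * indicator {s..} r \<partial>lborel)"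
    (is "?L = ?R")
proof -
  have nn: "0 \<le> P k (v - 1) / v" for v
    using P_nonneg[of k "v - 1"] P_eq_0[of "v - 1" k] by (cases "v < 0") auto
  have "?L = (\<integral>\<^sup>+w. (\<integral>\<^sup>+v. ennreal (s * exp (- s * w)) * (ennreal (P k (v - 1) / v) * indicator {v..} w) \<partial>lborel) \<partial>lborel)"
  proof (rule nn_integral_cong)
    fix w :: real
    have "(\<lambda>v. indicator {v..} w :: ennreal) = indicator {..w}" by (auto simp: indicator_def)
    then have [measurable]: "(\<lambda>v. indicator {v..} w :: ennreal) \<in> borel_measurable borel" by simp
    show "ennreal (s * exp (- s * w) * P (Suc k) w)
      = (\<integral>\<^sup>+v. ennreal (s * exp (- s * w)) * (ennreal (P k (v - 1) / v) * indicator {v..} w) \<partial>lborel)"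
      using s by (simp add: ennreal_mult P_nonneg P_Suc_eq_nn_integral nn_integral_cmult del: P.simps)
  qed
  also have "\<dots> = (\<integral>\<^sup>+v. (\<integral>\<^sup>+w. ennreal (s * exp (- s * w)) * (ennreal (P k (v - 1) / v) * indicator {v..} w) \<partial>lborel) \<partial>lborel)"
    by (rule lborel_pair.Fubini') (simp add: indicator_def, measurable)
  also have "\<dots> = (\<integral>\<^sup>+v. ennreal (P k (v - 1) / v * exp (- s * v)) \<partial>lborel)"
  proof (rule nn_integral_cong)
    fix v :: real
    have "(\<integral>\<^sup>+w. ennreal (s * exp (- s * w)) * (ennreal (P k (v - 1) / v) * indicator {v..} w) \<partial>lborel)
        = (\<integral>\<^sup>+w. ennreal (P k (v - 1) / v * s) * (ennreal (exp (- s * w)) * indicator {v..} w) \<partial>lborel)"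
      using s nn[of v] by (intro nn_integral_cong) (simp add: ennreal_mult mult_ac del: times_divide_eq_left times_divide_eq_right)
    also have "\<dots> = ennreal (P k (v - 1) / v * s) * ennreal (exp (- s * v) / s)"
      by (subst nn_integral_cmult, measurable) (simp only: nn_integral_exp_atLeast[OF s])
    also have "\<dots> = ennreal (P k (v - 1) / v * exp (- s * v))"
      using s mult_nonneg_nonneg[OF nn[of v], of s] by (subst ennreal_mult[symmetric]) auto
    finally show "(\<integral>\<^sup>+w. ennreal (s * exp (- s * w)) * (ennreal (P k (v - 1) / v) * indicator {v..} w) \<partial>lborel)
      = ennreal (P k (v - 1) / v * exp (- s * v))" .
  qed
  also have "\<dots> = (\<integral>\<^sup>+u. ennreal (P k u / (1 + u) * exp (- s * (1 + u))) \<partial>lborel)"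
    by (subst nn_integral_real_affine[where c = 1 and t = 1]) auto
  also have "\<dots> = (\<integral>\<^sup>+u. (\<integral>\<^sup>+r. ennreal (P k u) * (ennreal (exp (- (1 + u) * r)) * indicator {s..} r) \<partial>lborel) \<partial>lborel)"
  proof (rule nn_integral_cong)
    fix u :: real
    show "ennreal (P k u / (1 + u) * exp (- s * (1 + u)))
        = (\<integral>\<^sup>+r. ennreal (P k u) * (ennreal (exp (- (1 + u) * r)) * indicator {s..} r) \<partial>lborel)"
    proof (cases "u < 0")
      case True
      then show ?thesis by (simp add: P_eq_0)
    next
      case False
      have "(\<integral>\<^sup>+r. ennreal (P k u) * (ennreal (exp (- (1 + u) * r)) * indicator {s..} r) \<partial>lborel)
          = ennreal (P k u) * ennreal (exp (- (1 + u) * s) / (1 + u))"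
        using nn_integral_exp_atLeast[of "1 + u" s] False by (subst nn_integral_cmult) auto
      also have "\<dots> = ennreal (P k u / (1 + u) * exp (- s * (1 + u)))"
        using False by (subst ennreal_mult[symmetric]) (auto simp: P_nonneg algebra_simps)
      finally show ?thesis ..
    qed
  qed
  also have "\<dots> = (\<integral>\<^sup>+r. (\<integral>\<^sup>+u. ennreal (P k u) * (ennreal (exp (- (1 + u) * r)) * indicator {s..} r) \<partial>lborel) \<partial>lborel)"
    by (rule lborel_pair.Fubini'[symmetric]) (simp add: indicator_def, measurable)
  also have "\<dots> = ?R"
  proof (rule nn_integral_cong)
    fix r :: real
    show "(\<integral>\<^sup>+u. ennreal (P k u) * (ennreal (exp (- (1 + u) * r)) * indicator {s..} r) \<partial>lborel)
        = ennreal (exp (- r) / r) * (\<integral>\<^sup>+u. ennreal (r * exp (- r * u) * P k u) \<partial>lborel) * indicator {s..} r"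
    proof (cases "s \<le> r")
      case True
      with s have r: "r > 0" by simp
      have "ennreal (P k u) * ennreal (exp (- (1 + u) * r))
          = ennreal (exp (- r) / r) * ennreal (r * exp (- r * u) * P k u)" for u
        using r by (subst (1 2) ennreal_mult[symmetric])
          (auto simp: P_nonneg mult_ac exp_add[symmetric] algebra_simps)
      with True show ?thesis by (simp add: nn_integral_cmult)
    qed auto
  qed
  finally show ?thesis .
qed

text \<open>Induction along the recursion: exp(-r)/r E(r)^k/k! is the derivative of
  -E(r)^(k+1)/(k+1)!, whose boundary term at infinity is 0 because E tends to 0.\<close>

lemma nn_integral_P_exp:
  assumes E: "\<And>s. s > 0 \<Longrightarrow> (E has_real_derivative - (exp (- s) / s)) (at s)"
    and lim: "(E \<longlongrightarrow> 0) at_top" and s: "s > 0"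
  shows "(\<integral>\<^sup>+u. ennreal (s * exp (- s * u) * P k u) \<partial>lborel) = ennreal (E s ^ k / fact k)"
  using s
proof (induction k arbitrary: s)
  case 0
  have "(\<integral>\<^sup>+u. ennreal (s * exp (- s * u) * P 0 u) \<partial>lborel)
      = (\<integral>\<^sup>+u. ennreal s * (ennreal (exp (- s * u)) * indicator {0..} u) \<partial>lborel)"
    using 0 by (intro nn_integral_cong) (auto simp: ennreal_mult indicator_def)
  also have "\<dots> = 1"
    using 0 nn_integral_exp_atLeast[of s 0]
    by (subst nn_integral_cmult) (auto simp: ennreal_mult[symmetric] simp del: ennreal_1 simp flip: ennreal_1)
  finally show ?case by simp
next
  case (Suc k)
  note E_nonneg = exponential_integral_nonneg[OF E lim]
  have "(\<integral>\<^sup>+u. ennreal (s * exp (- s * u) * P (Suc k) u) \<partial>lborel)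
      = (\<integral>\<^sup>+r. ennreal (exp (- r) / r * (E r ^ k / fact k)) * indicator {s..} r \<partial>lborel)"
    unfolding nn_integral_P_Suc_exp[OF Suc.prems]
    using Suc.prems Suc.IH
    by (intro nn_integral_cong)
      (auto simp: indicator_def ennreal_mult[symmetric] E_nonneg simp del: P.simps)
  \<comment> \<open>The integrand is set to 0 for r <= 0, where nothing is known about
    \<open>E\<close>, to obtain a Borel function on the whole line.\<close>
  also have "\<dots> = (\<integral>\<^sup>+r. ennreal (if r \<in> {0<..} then exp (- r) / r * (E r ^ k / fact k) else 0) * indicator {s..} r \<partial>lborel)"
    using Suc.prems by (intro nn_integral_cong) (auto simp: indicator_def)
  also have "\<dots> = ennreal (0 - (- (E s ^ Suc k / fact (Suc k))))"
  proof (rule nn_integral_FTC_atLeast)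
    have "continuous_on {0<..} E"
      by (rule DERIV_continuous_on[OF has_field_derivative_at_within[OF E]]) auto
    then show "(\<lambda>r. if r \<in> {0<..} then exp (- r) / r * (E r ^ k / fact k) else 0) \<in> borel_measurable borel"
      by (intro borel_measurable_continuous_on_if continuous_intros) auto
    have "((\<lambda>r. - (E r ^ Suc k / fact (Suc k))) \<longlongrightarrow> - (0 ^ Suc k / fact (Suc k))) at_top"
      by (intro tendsto_intros lim) auto
    then show "((\<lambda>r. - (E r ^ Suc k / fact (Suc k))) \<longlongrightarrow> 0) at_top" by simp
    fix x assume "s \<le> x"
    with Suc.prems have x: "x > 0" by simp
    then show "0 \<le> (if x \<in> {0<..} then exp (- x) / x * (E x ^ k / fact k) else 0)"
      by (simp add: E_nonneg)
    have "((\<lambda>r. - (E r ^ Suc k / fact (Suc k))) has_real_derivative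
       - ((1 + real k) * (- (exp (- x) / x) * E x ^ k) / fact (Suc k))) (at x)"
      by (rule DERIV_minus[OF DERIV_cdivide[OF DERIV_power_Suc[OF E[OF x]]]])
    also have "- ((1 + real k) * (- (exp (- x) / x) * E x ^ k) / fact (Suc k)) = exp (- x) / x * (E x ^ k / fact k)"
      using x by (simp add: divide_simps)
    finally show "((\<lambda>r. - (E r ^ Suc k / fact (Suc k))) has_real_derivative
       (if x \<in> {0<..} then exp (- x) / x * (E x ^ k / fact k) else 0)) (at x)" using x by simp
  qed
  finally show ?case by simp
qed

section \<open>Logarithmic moments of the exponential distribution\<close>

lemma has_fps_expansion_nth_0:
  "f has_fps_expansion F \<Longrightarrow> fps_nth F 0 = f (0::real)"
  unfolding has_fps_expansion_def by (auto simp: eval_fps_at_0 dest: eventually_nhds_x_imp_x)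

lemma fps_nth_has_fps_expansion_real:
  fixes f :: "real \<Rightarrow> real"
  assumes "f has_fps_expansion F"
  shows "fps_nth F n = (deriv ^^ n) f 0 / fact n"
  using assms
proof (induction n arbitrary: f F)
  case 0
  then show ?case by (simp add: has_fps_expansion_nth_0)
next
  case (Suc n)
  have "fps_nth F (Suc n) = fps_nth (fps_deriv F) n / real (Suc n)"
    by (simp add: fps_deriv_def del: of_nat_Suc)
  also have "fps_nth (fps_deriv F) n = (deriv ^^ n) (deriv f) 0 / fact n"
    by (rule Suc.IH[OF has_fps_expansion_deriv[OF Suc.prems]])
  also have "(deriv ^^ n) (deriv f) = (deriv ^^ Suc n) f"
    by (simp only: funpow_Suc_right o_apply)
  finally show ?case
    by (simp only: fact_Suc divide_divide_eq_left mult.commute of_nat_mult)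
qed

text \<open>The coefficients are Taylor coefficients, hence determined by the function near
  0.\<close>

lemma fps_expansion_unique_real:
  fixes f g :: "real \<Rightarrow> real"
  assumes f: "f has_fps_expansion F" and g: "g has_fps_expansion G"
    and ev: "eventually (\<lambda>x. f x = g x) (nhds 0)"
  shows "F = G"
proof -
  have "f has_fps_expansion G"
    using g ev unfolding has_fps_expansion_def by (auto elim: eventually_elim2)
  with f show ?thesis
    by (intro fps_ext) (simp add: fps_nth_has_fps_expansion_real)
qed

lemma has_fps_expansion_derivative:
  assumes "f has_fps_expansion F" "r > 0"
    and "\<And>x. \<bar>x\<bar> < r \<Longrightarrow> (f has_real_derivative g x) (at x)"
  shows "g has_fps_expansion fps_deriv F"
proof -
  have "eventually (\<lambda>x::real. x \<in> ball 0 r) (nhds 0)"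
    using assms(2) by (intro eventually_nhds_in_open) auto
  then have "eventually (\<lambda>x. deriv f x = g x) (nhds 0)"
    by eventually_elim (use assms(3) in \<open>auto intro: DERIV_imp_deriv\<close>)
  then show ?thesis
    using has_fps_expansion_deriv[OF assms(1)] unfolding has_fps_expansion_def
    by (auto elim: eventually_elim2)
qed

text \<open>The standard exponential distribution: with t = su, the transform
  \<open>\<Lambda>\<^sub>k(s)\<close> becomes the mean of P_k(t/s), for k > 0.\<close>

definition exp_measure :: "real measure" where
  "exp_measure = density lborel (\<lambda>t. ennreal (indicator {0<..} t * exp (- t)))"

lemma sets_exp_measure [simp, measurable_cong]: "sets exp_measure = sets borel"
  and space_exp_measure [simp]: "space exp_measure = UNIV"
  by (auto simp: exp_measure_def)

lemma AE_exp_measure_pos: "AE t in exp_measure. t > 0"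
  unfolding exp_measure_def by (subst AE_density) (auto simp: indicator_def)

lemma nn_integral_exp_measure:
  "f \<in> borel_measurable borel \<Longrightarrow>
    (\<integral>\<^sup>+t. f t \<partial>exp_measure) = (\<integral>\<^sup>+t. ennreal (indicator {0<..} t * exp (- t)) * f t \<partial>lborel)"
  unfolding exp_measure_def by (subst nn_integral_density) auto

lemma has_bochner_integral_exp_measure_powr:
  fixes a :: real
  assumes "a > -1"
  shows "has_bochner_integral exp_measure (\<lambda>t. t powr a) (Gamma (1 + a))"
proof (rule has_bochner_integral_nn_integral)
  have "(\<integral>\<^sup>+t. ennreal (t powr a) \<partial>exp_measure)
      = (\<integral>\<^sup>+t. ennreal (indicator {0..} t * t powr (1 + a - 1) / exp t) \<partial>lborel)"
    by (subst nn_integral_exp_measure)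
      (auto intro!: nn_integral_cong simp: indicator_def exp_minus field_simps ennreal_mult[symmetric])
  also have "\<dots> = ennreal (Gamma (1 + a))"
    using assms by (subst Gamma_conv_nn_integral_real) auto
  finally show "(\<integral>\<^sup>+t. ennreal (t powr a) \<partial>exp_measure) = ennreal (Gamma (1 + a))" .
  show "0 \<le> Gamma (1 + a)" using assms by (intro less_imp_le Gamma_real_pos) auto
qed auto

text \<open>The mean of log t is minus the Euler-Mascheroni constant, so this centring makes the
  first moment vanish.\<close>

abbreviation ln_centred :: "real \<Rightarrow> real" where
  "ln_centred t \<equiv> ln t + euler_mascheroni"

definition ln_moment :: "nat \<Rightarrow> real" where
  "ln_moment n = (\<integral>t. ln_centred t ^ n \<partial>exp_measure)"

lemma has_bochner_integral_exp_ln_centred: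
  fixes x :: real
  assumes "x > -1"
  shows "has_bochner_integral exp_measure (\<lambda>t. exp (x * ln_centred t)) (Gamma (1 + x) * exp (x * euler_mascheroni))"
proof -
  have "has_bochner_integral exp_measure (\<lambda>t. t powr x * exp (x * euler_mascheroni)) (Gamma (1 + x) * exp (x * euler_mascheroni))"
    using assms by (intro has_bochner_integral_mult_left has_bochner_integral_exp_measure_powr)
  also have "?this \<longleftrightarrow> ?thesis"
    using AE_exp_measure_pos
    by (intro has_bochner_integral_cong_AE) (auto simp: powr_def exp_add[symmetric] algebra_simps)
  finally show ?thesis .
qed

lemma power_div_fact_le_exp:
  fixes y :: real
  assumes "y \<ge> 0"
  shows "y ^ n / fact n \<le> exp y"
proof -
  have s: "(\<lambda>n. y ^ n /\<^sub>R fact n) sums exp y" by (rule exp_converges)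
  have "(\<Sum>n\<in>{n}. y ^ n /\<^sub>R fact n) \<le> (\<Sum>n. y ^ n /\<^sub>R fact n)"
    using s assms by (intro sum_le_suminf) (auto simp: sums_iff)
  then show ?thesis using s by (simp add: sums_iff field_simps)
qed

lemma integrable_cosh_ln_centred:
  "integrable exp_measure (\<lambda>t. exp (1/2 * ln_centred t) + exp (- 1/2 * ln_centred t))"
  using has_bochner_integral_exp_ln_centred[of "1/2"] has_bochner_integral_exp_ln_centred[of "-1/2"]
  by (intro Bochner_Integration.integrable_add) (auto simp: has_bochner_integral_iff)

text \<open>The exponential series at |l|/2, whence the factor 2^n. The exponents 1/2 and -1/2 both
  exceed -1, so with l = \<open>ln_centred t\<close> the right-hand side is integrable and dominates
  every power of the logarithm.\<close>

lemma power_div_fact_bound: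
  fixes l :: real
  shows "\<bar>l ^ n\<bar> / fact n \<le> 2 ^ n * (exp (1/2 * l) + exp (- 1/2 * l))"
proof -
  have "\<bar>l ^ n\<bar> / fact n = 2 ^ n * ((\<bar>l\<bar> / 2) ^ n / fact n)"
    by (simp add: power_abs power_divide)
  also have "\<dots> \<le> 2 ^ n * exp (\<bar>l\<bar> / 2)"
    by (intro mult_left_mono power_div_fact_le_exp) auto
  also have "\<dots> \<le> 2 ^ n * (exp (1/2 * l) + exp (- 1/2 * l))"
    by (intro mult_left_mono) (auto simp: abs_if add_increasing add_increasing2)
  finally show ?thesis .
qed

lemma integrable_ln_centred_power: "integrable exp_measure (\<lambda>t. ln_centred t ^ n)"
proof (rule Bochner_Integration.integrable_bound)
  show "integrable exp_measure (\<lambda>t. fact n * (2 ^ n * (exp (1/2 * ln_centred t) + exp (- 1/2 * ln_centred t))))"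
    by (intro integrable_mult_right integrable_cosh_ln_centred)
  show "AE t in exp_measure. norm (ln_centred t ^ n)
      \<le> norm (fact n * (2 ^ n * (exp (1/2 * ln_centred t) + exp (- 1/2 * ln_centred t))))"
    using power_div_fact_bound[of "ln_centred _" n] by (intro AE_I2) (simp add: pos_divide_le_eq mult_ac)
qed auto

text \<open>The exponential series of exp(x \<open>ln_centred t\<close>) is integrated term by term.
  The norms of its terms integrate to at most a constant times (2|x|)^n, which explains the radius
  1/2.\<close>

lemma ln_moment_sums:
  fixes x :: real
  assumes "\<bar>x\<bar> < 1/2"
  shows "(\<lambda>n. ln_moment n / fact n * x ^ n) sums (Gamma (1 + x) * exp (x * euler_mascheroni))"
proof -
  let ?W = "\<lambda>t. exp (1/2 * ln_centred t) + exp (- 1/2 * ln_centred t)"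
  let ?f = "\<lambda>n t. (x * ln_centred t) ^ n /\<^sub>R fact n"
  have exps: "(\<lambda>n. ?f n t) sums exp (x * ln_centred t)" for t
    by (rule exp_converges)
  have int: "integrable exp_measure (?f n)" for n
    using integrable_ln_centred_power[of n] by (simp add: power_mult_distrib)
  have "(\<lambda>n. integral\<^sup>L exp_measure (?f n)) sums (\<integral>t. (\<Sum>n. ?f n t) \<partial>exp_measure)"
  proof (rule sums_integral[OF int])
    show "AE t in exp_measure. summable (\<lambda>n. norm (?f n t))"
      by (intro AE_I2 summable_norm_exp)
    show "summable (\<lambda>n. \<integral>t. norm (?f n t) \<partial>exp_measure)"
    proof (rule summable_comparison_test')
      show "summable (\<lambda>n. (2 * \<bar>x\<bar>) ^ n * (\<integral>t. ?W t \<partial>exp_measure))"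
        using assms by (intro summable_mult2 summable_geometric) auto
      fix n
      have "(\<integral>t. norm (?f n t) \<partial>exp_measure) \<le> (\<integral>t. (2 * \<bar>x\<bar>) ^ n * ?W t \<partial>exp_measure)"
      proof (rule integral_mono)
        show "integrable exp_measure (\<lambda>t. (2 * \<bar>x\<bar>) ^ n * ?W t)"
          by (intro integrable_mult_right integrable_cosh_ln_centred)
        fix t
        have "norm (?f n t) = \<bar>x\<bar> ^ n * (\<bar>ln_centred t ^ n\<bar> / fact n)"
          by (simp add: power_mult_distrib abs_mult power_abs divide_inverse)
        also have "\<dots> \<le> \<bar>x\<bar> ^ n * (2 ^ n * ?W t)"
          by (intro mult_left_mono power_div_fact_bound) auto
        finally show "norm (?f n t) \<le> (2 * \<bar>x\<bar>) ^ n * ?W t"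
          by (simp add: power_mult_distrib mult_ac)
      qed (use int in auto)
      then show "norm (\<integral>t. norm (?f n t) \<partial>exp_measure) \<le> (2 * \<bar>x\<bar>) ^ n * (\<integral>t. ?W t \<partial>exp_measure)"
        using integrable_cosh_ln_centred by (simp add: integral_nonneg)
    qed
  qed
  also have "(\<lambda>t. \<Sum>n. ?f n t) = (\<lambda>t. exp (x * ln_centred t))"
    using exps by (simp add: sums_iff)
  also have "(\<integral>t. exp (x * ln_centred t) \<partial>exp_measure) = Gamma (1 + x) * exp (x * euler_mascheroni)"
    using has_bochner_integral_exp_ln_centred[of x] assms by (auto simp: has_bochner_integral_iff)
  also have "(\<lambda>n. integral\<^sup>L exp_measure (?f n)) = (\<lambda>n. ln_moment n / fact n * x ^ n)"
    by (simp add: ln_moment_def power_mult_distrib divide_inverse mult_ac)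
  finally show ?thesis .
qed

lemma Polygamma_1_eq_zeta:
  assumes "n > 0"
  shows "Polygamma n (1::real) = (-1) ^ Suc n * fact n * zeta_val (Suc n)"
proof -
  have "(\<lambda>k. inverse ((1 + real k) ^ Suc n)) sums ((-1) ^ Suc n * Polygamma n 1 / fact n)"
    using assms by (intro Polygamma_LIMSEQ) auto
  moreover have "zeta_val (Suc n) = (\<Sum>k. inverse ((1 + real k) ^ Suc n))"
    unfolding zeta_val_def Li_def by (simp add: inverse_eq_divide add_ac)
  ultimately have "zeta_val (Suc n) = (-1) ^ Suc n * Polygamma n 1 / fact n"
    by (simp add: sums_iff)
  then show ?thesis
    by (cases "even n") (auto simp: field_simps)
qed

lemma eventually_abs_less_half: "eventually (\<lambda>x::real. \<bar>x\<bar> < 1/2) (nhds 0)"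
  using eventually_nhds_in_open[of "ball 0 (1/2)" "0::real"] by (simp add: dist_real_def)

lemma ln_moment_fps_expansion:
  "(\<lambda>x. Gamma (1 + x) * exp (x * euler_mascheroni)) has_fps_expansion Abs_fps (\<lambda>n. ln_moment n / fact n)"
  using eventually_abs_less_half ln_moment_sums
  by (intro has_fps_expansionI) (auto elim: eventually_mono)

text \<open>With A = Digamma(1+x) + gamma, the generating function M satisfies M' = M A, so its
  derivatives are M times the complete Bell polynomials in A and its derivatives B, C, D. At 0 one
  has M = 1, A = 0, B = zeta_2 and D = 6 zeta_4.\<close>

lemma ln_moment_values:
  shows ln_moment_0: "ln_moment 0 = 1"
    and ln_moment_1: "ln_moment 1 = 0"
    and ln_moment_2: "ln_moment 2 = zeta_val 2"
    and ln_moment_4: "ln_moment 4 = 3 * (zeta_val 2)\<^sup>2 + 6 * zeta_val 4"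
proof -
  define M :: "real \<Rightarrow> real" where "M = (\<lambda>x. Gamma (1 + x) * exp (x * euler_mascheroni))"
  define A :: "real \<Rightarrow> real" where "A = (\<lambda>x. Digamma (1 + x) + euler_mascheroni)"
  define B C D :: "real \<Rightarrow> real" where "B = (\<lambda>x. Polygamma 1 (1 + x))"
    and "C = (\<lambda>x. Polygamma 2 (1 + x))" and "D = (\<lambda>x. Polygamma 3 (1 + x))"
  have npos: "1 + x \<notin> \<int>\<^sub>\<le>\<^sub>0" if "\<bar>x\<bar> < 1/2" for x :: real
    using that by (auto elim!: nonpos_Ints_cases')
  have M: "(M has_real_derivative M x * A x) (at x)"
    and A: "(A has_real_derivative B x) (at x)"
    and B: "(B has_real_derivative C x) (at x)"
    and C: "(C has_real_derivative D x) (at x)" if "\<bar>x\<bar> < 1/2" for x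
    unfolding M_def A_def B_def C_def D_def
    by (auto intro!: derivative_eq_intros simp: npos[OF that] algebra_simps numeral_2_eq_2 numeral_3_eq_3)
  let ?F = "Abs_fps (\<lambda>n. ln_moment n / fact n)"
  have 0: "M has_fps_expansion ?F"
    using ln_moment_fps_expansion by (simp add: M_def)
  have 1: "(\<lambda>x. M x * A x) has_fps_expansion fps_deriv ?F"
    by (rule has_fps_expansion_derivative[OF 0, of "1/2"]) (auto intro!: M)
  have 2: "(\<lambda>x. M x * (A x ^ 2 + B x)) has_fps_expansion fps_deriv (fps_deriv ?F)"
    by (rule has_fps_expansion_derivative[OF 1, of "1/2"])
      (auto intro!: derivative_eq_intros M A simp: algebra_simps power2_eq_square)
  have 3: "(\<lambda>x. M x * (A x ^ 3 + 3 * A x * B x + C x)) has_fps_expansion fps_deriv (fps_deriv (fps_deriv ?F))"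
    by (rule has_fps_expansion_derivative[OF 2, of "1/2"])
      (auto intro!: derivative_eq_intros M A B simp: algebra_simps power2_eq_square power3_eq_cube)
  have 4: "(\<lambda>x. M x * (A x ^ 4 + 6 * A x ^ 2 * B x + 4 * A x * C x + 3 * B x ^ 2 + D x))
      has_fps_expansion fps_deriv (fps_deriv (fps_deriv (fps_deriv ?F)))"
    by (rule has_fps_expansion_derivative[OF 3, of "1/2"])
      (auto intro!: derivative_eq_intros M A B C simp: algebra_simps eval_nat_numeral)
  have M0: "M 0 = 1" and A0: "A 0 = 0" by (auto simp: M_def A_def)
  show "ln_moment 0 = 1" using has_fps_expansion_nth_0[OF 0] M0 by simp
  show "ln_moment 1 = 0" using has_fps_expansion_nth_0[OF 1] M0 A0 by simp
  show "ln_moment 2 = zeta_val 2" using has_fps_expansion_nth_0[OF 2] M0 A0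
    by (simp add: B_def Polygamma_1_eq_zeta eval_nat_numeral)
  have "ln_moment 4 = 3 * B 0 ^ 2 + D 0" using has_fps_expansion_nth_0[OF 4] M0 A0
    by (simp add: eval_nat_numeral)
  then show "ln_moment 4 = 3 * (zeta_val 2)\<^sup>2 + 6 * zeta_val 4"
    by (simp add: B_def D_def Polygamma_1_eq_zeta eval_nat_numeral)
qed

section \<open>The reflection formula and the value of zeta_4\<close>

lemma Gamma_reflection_real_sin:
  fixes x :: real
  assumes "\<bar>x\<bar> < 1"
  shows "Gamma (1 + x) * Gamma (1 - x) * sin (pi * x) = pi * x"
proof (cases "x = 0")
  case False
  have "x \<notin> \<int>"
  proof
    assume "x \<in> \<int>"
    then obtain n where "x = of_int n" by (elim Ints_cases)
    with assms False show False by auto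
  qed
  have "complex_of_real (Gamma x * Gamma (1 - x)) = complex_of_real (pi / sin (pi * x))"
    using Gamma_reflection_complex[of "of_real x"]
    by (simp add: Gamma_complex_of_real[symmetric] sin_of_real[symmetric])
  then have "Gamma x * Gamma (1 - x) = pi / sin (pi * x)"
    by (simp only: of_real_eq_iff)
  moreover have "Gamma (1 + x) = x * Gamma x"
    using Gamma_plus1[of x] \<open>x \<notin> \<int>\<close> by (auto simp: add_ac dest: nonpos_Ints_Int)
  moreover have "sin (pi * x) \<noteq> 0"
    using \<open>x \<notin> \<int>\<close> by (auto simp: sin_zero_iff_int2 mult.commute)
  ultimately show ?thesis by (simp add: eq_divide_eq mult_ac)
qed auto

lemma fps_nth_mult_sin:
  fixes H :: "real fps"
  assumes "fps_nth H 0 = 1" "fps_nth H 1 = 0" "fps_nth H 3 = 0"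
  shows "fps_nth (H * fps_sin c) 3 = fps_nth H 2 * c - c ^ 3 / 6"
    and "fps_nth (H * fps_sin c) 5 = fps_nth H 4 * c - fps_nth H 2 * c ^ 3 / 6 + c ^ 5 / 120"
proof -
  have sin: "fps_nth (fps_sin c) 0 = 0" "fps_nth (fps_sin c) 1 = c" "fps_nth (fps_sin c) 2 = 0"
    "fps_nth (fps_sin c) 3 = - (c ^ 3 / 6)" "fps_nth (fps_sin c) 4 = 0" "fps_nth (fps_sin c) 5 = c ^ 5 / 120"
    by (simp_all add: fps_sin_def fact_numeral)
  have sets: "{0..3} = {0, 1, 2, 3::nat}" "{0..5} = {0, 1, 2, 3, 4, 5::nat}" by auto
  show "fps_nth (H * fps_sin c) 3 = fps_nth H 2 * c - c ^ 3 / 6"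
    and "fps_nth (H * fps_sin c) 5 = fps_nth H 4 * c - fps_nth H 2 * c ^ 3 / 6 + c ^ 5 / 120"
    using assms sin by (simp_all add: fps_mult_nth sets)
qed

text \<open>In Gamma(1+x) Gamma(1-x) sin(pi x) = pi x the factors exp(gamma x) and exp(-gamma x) may
  be inserted, which expresses the left-hand series through the log moments. The coefficient of x^3
  gives pi^2 = 6 zeta_2; inserting this in the coefficient of x^5 gives zeta_4.\<close>

lemma zeta_4_eq: "zeta_val 4 = 2 / 5 * (zeta_val 2)\<^sup>2"
proof -
  let ?F = "Abs_fps (\<lambda>n. ln_moment n / fact n)" and ?G = "Abs_fps (\<lambda>n. (-1) ^ n * ln_moment n / fact n)"
  have "((\<lambda>n. fps_nth ?G n * x ^ n) sums (Gamma (1 - x) * exp (- (x * euler_mascheroni))))" if "\<bar>x\<bar> < 1/2" for x :: real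
    using ln_moment_sums[of "- x"] that by (simp add: power_minus[of x] mult_ac)
  then have G: "(\<lambda>x. Gamma (1 - x) * exp (- (x * euler_mascheroni))) has_fps_expansion ?G"
    using eventually_abs_less_half by (intro has_fps_expansionI) (auto elim: eventually_mono)
  have lhs: "(\<lambda>x. (Gamma (1 + x) * exp (x * euler_mascheroni)) * (Gamma (1 - x) * exp (- (x * euler_mascheroni))) * sin (pi * x))
    has_fps_expansion ?F * ?G * fps_sin pi"
    by (intro has_fps_expansion_mult ln_moment_fps_expansion G has_fps_expansion_sin)
  have rhs: "(\<lambda>x::real. pi * x) has_fps_expansion fps_const pi * fps_X"
    by (intro has_fps_expansion_cmult_left has_fps_expansion_fps_X)
  have eq: "?F * ?G * fps_sin pi = fps_const pi * fps_X"
  proof (rule fps_expansion_unique_real[OF lhs rhs])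
    show "\<forall>\<^sub>F x in nhds 0. (Gamma (1 + x) * exp (x * euler_mascheroni)) * (Gamma (1 - x) * exp (- (x * euler_mascheroni))) * sin (pi * x) = pi * x"
      using eventually_abs_less_half
    proof eventually_elim
      case (elim x)
      then show ?case
        using Gamma_reflection_real_sin[of x] by (simp add: exp_minus field_simps)
    qed
  qed
  let ?H = "?F * ?G"
  \<comment> \<open>\<open>?G\<close> is \<open>?F\<close> with x replaced by -x, so the odd
    coefficients of the product cancel.\<close>
  have H: "fps_nth ?H 0 = 1" "fps_nth ?H 1 = 0" "fps_nth ?H 2 = zeta_val 2" "fps_nth ?H 3 = 0"
    "fps_nth ?H 4 = ln_moment 4 / 12 + (zeta_val 2)\<^sup>2 / 4"
    using ln_moment_0 ln_moment_1 ln_moment_2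
    by (simp_all add: fps_mult_nth eval_nat_numeral)
  have "fps_nth (?H * fps_sin pi) 3 = 0" "fps_nth (?H * fps_sin pi) 5 = 0"
    unfolding eq by simp_all
  then have "zeta_val 2 * pi - pi ^ 3 / 6 = 0"
    and "(ln_moment 4 / 12 + (zeta_val 2)\<^sup>2 / 4) * pi - zeta_val 2 * pi ^ 3 / 6 + pi ^ 5 / 120 = 0"
    by (simp_all only: fps_nth_mult_sin[OF H(1,2,4)] H)
  then have "pi * (zeta_val 2 - pi\<^sup>2 / 6) = 0"
    and "pi * (ln_moment 4 / 12 + (zeta_val 2)\<^sup>2 / 4 - zeta_val 2 * pi\<^sup>2 / 6 + (pi\<^sup>2)\<^sup>2 / 120) = 0"
    by (simp_all add: algebra_simps eval_nat_numeral)
  then have "pi\<^sup>2 = 6 * zeta_val 2"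
    and "ln_moment 4 / 12 + (zeta_val 2)\<^sup>2 / 4 - zeta_val 2 * pi\<^sup>2 / 6 + (pi\<^sup>2)\<^sup>2 / 120 = 0"
    by simp_all
  then show ?thesis
    by (simp add: ln_moment_4 power2_eq_square)
qed

section \<open>The derivative of the right-hand side\<close>

text \<open>The integrand of \<open>H4\<close> with \<open>Li 1 (- 2 * x)\<close> in closed form:
  this is continuous on (0,1], whereas the series diverges for x > 1/2.\<close>

definition H4_integrand :: "real \<Rightarrow> real" where
  "H4_integrand x = (ln (x / (1 + 2 * x)) * Li 2 x - 1 / 2 * (ln x)\<^sup>2 * ln (1 + 2 * x)) / (x * (1 + x))"

lemma H4_eq:
  assumes "y \<le> 1/2"
  shows "H4 y = integral {0..y} H4_integrand"
  unfolding H4_def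
\<comment> \<open>At x = 1/2 the argument -2x = -1 lies on the boundary, outside the scope of
  \<open>Li_1\<close>; a single point is negligible.\<close>
proof (rule integral_spike[of "{1/2}"])
  fix x assume x: "x \<in> {0..y} - {1/2}"
  then have "Li 1 (- 2 * x) = - ln (1 + 2 * x)"
    using assms Li_1[of "-2 * x"] by auto
  then show "H4_integrand x = (ln (x / (1 + 2 * x)) * Li 2 x + 1 / 2 * (ln x) ^ 2 * Li 1 (- 2 * x)) / (x * (1 + x))"
    unfolding H4_integrand_def by simp
qed auto

lemma continuous_on_H4_integrand: "continuous_on {0<..1} H4_integrand"
  unfolding H4_integrand_def
  by (intro continuous_intros continuous_on_compose2[OF continuous_on_Li]) auto

text \<open>With w = x^(-1/4), the inequality log w <= w - 1 gives |log x| <= 4w, so up to two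
  logarithms cost at most a multiple of w^2 = x^(-1/2). The factors Li_2(x) and log(1+2x) are O(x)
  and absorb the denominator x. The constant is 26 = 10 + 16, one part from each summand.\<close>

lemma H4_integrand_bound:
  assumes "0 < x" "x \<le> 1/2"
  shows "\<bar>H4_integrand x\<bar> \<le> 26 * x powr (-1/2)"
proof -
  define w where "w = x powr (-1/4)"
  have w: "w \<ge> 1" unfolding w_def using assms by (simp add: powr_minus field_simps powr_le1)
  have w2: "w\<^sup>2 = x powr (-1/2)" unfolding w_def power2_eq_square using assms by (simp flip: powr_add)
  have "ln w = - ln x / 4" unfolding w_def using assms by (simp add: ln_powr)
  moreover have "ln w \<le> w - 1" using w by (intro ln_le_minus_one) auto
  moreover have "ln x \<le> 0" using assms by simp
  ultimately have lnx: "\<bar>ln x\<bar> \<le> 4 * w" using w by linarith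
  have ln12: "0 \<le> ln (1 + 2 * x)" "ln (1 + 2 * x) \<le> 2 * x"
    using assms ln_add_one_self_le_self[of "2 * x"] by auto
  have "\<bar>ln (x / (1 + 2 * x))\<bar> \<le> \<bar>ln x\<bar> + \<bar>ln (1 + 2 * x)\<bar>"
    using assms by (simp add: ln_div)
  also have "\<dots> \<le> 4 * w + 1" using lnx ln12 assms by linarith
  finally have "\<bar>ln (x / (1 + 2 * x)) * Li 2 x\<bar> \<le> (4 * w + 1) * (2 * x)"
    unfolding abs_mult using abs_Li_le[of x 2] assms w by (intro mult_mono) auto
  also have "\<dots> \<le> (5 * w\<^sup>2) * (2 * x)"
  proof (intro mult_right_mono)
    have "w \<le> w\<^sup>2" "1 \<le> w\<^sup>2" using w by (auto simp: power2_eq_square mult_ge1_I)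
    then show "4 * w + 1 \<le> 5 * w\<^sup>2" by linarith
  qed (use assms in auto)
  finally have 1: "\<bar>ln (x / (1 + 2 * x)) * Li 2 x\<bar> \<le> 10 * w\<^sup>2 * x" by simp
  have "(ln x)\<^sup>2 \<le> (4 * w)\<^sup>2" using lnx by (metis abs_ge_zero power2_abs power_mono)
  then have 2: "\<bar>1 / 2 * (ln x)\<^sup>2 * ln (1 + 2 * x)\<bar> \<le> 1 / 2 * (4 * w)\<^sup>2 * (2 * x)"
    unfolding abs_mult using ln12 assms by (intro mult_mono) auto
  have "\<bar>ln (x / (1 + 2 * x)) * Li 2 x - 1 / 2 * (ln x)\<^sup>2 * ln (1 + 2 * x)\<bar> \<le> 26 * w\<^sup>2 * x"
    using 1 2 by (simp add: power_mult_distrib abs_le_iff)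
  also have "\<dots> \<le> 26 * w\<^sup>2 * (x * (1 + x))"
    using assms by (intro mult_left_mono) auto
  finally show ?thesis
    unfolding H4_integrand_def w2[symmetric] using assms
    by (simp add: abs_divide pos_divide_le_eq abs_mult)
qed

lemma integrable_H4_integrand: "0 \<le> y \<Longrightarrow> y \<le> 1/2 \<Longrightarrow> H4_integrand integrable_on {0..y}"
proof -
  assume y: "0 \<le> y" "y \<le> 1/2"
  have "H4_integrand integrable_on {0<..y}"
  proof (rule measurable_bounded_by_integrable_imp_integrable)
    show "H4_integrand \<in> borel_measurable (lebesgue_on {0<..y})"
      using y by (intro continuous_imp_measurable_on_sets_lebesgue continuous_on_subset[OF continuous_on_H4_integrand]) auto
    have "(\<lambda>x. x powr (-1/2)) integrable_on {0..y}"
      using has_integral_powr_from_0[of "-1/2" y] y by (auto simp: integrable_on_def)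
    then have "(\<lambda>x. 26 * x powr (-1/2)) integrable_on {0..y}"
      by (rule integrable_on_mult_right)
    then show "(\<lambda>x. 26 * x powr (-1/2)) integrable_on {0<..y}"
      by (rule integrable_spike_set) (auto intro: negligible_subset[of "{0}"])
  qed (use y H4_integrand_bound in auto)
  then show ?thesis
    by (rule integrable_spike_set) (auto intro: negligible_subset[of "{0}"])
qed

lemma abs_H4_le:
  assumes "0 \<le> y" "y \<le> 1/2"
  shows "\<bar>H4 y\<bar> \<le> 52 * y powr (1/2)"
proof -
  have I: "((\<lambda>x. 26 * x powr (-1/2)) has_integral 26 * (y powr (-1/2 + 1) / (-1/2 + 1))) {0..y}"
    using assms by (intro has_integral_mult_right has_integral_powr_from_0) auto
  have "norm (integral {0..y} H4_integrand) \<le> integral {0..y} (\<lambda>x. 26 * x powr (-1/2))"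
  proof (rule integral_norm_bound_integral)
    fix x assume "x \<in> {0..y}"
    \<comment> \<open>At x = 0 both sides are 0, by division by zero and by the convention for
      powers of 0.\<close>
    then show "norm (H4_integrand x) \<le> 26 * x powr (-1/2)"
      using H4_integrand_bound[of x] assms by (cases "x = 0") (auto simp: H4_integrand_def)
  qed (use I assms integrable_H4_integrand in \<open>auto simp: integrable_on_def\<close>)
  also have "\<dots> = 52 * y powr (1/2)" using integral_unique[OF I] by simp
  finally show ?thesis using assms by (simp add: H4_eq)
qed

lemma continuous_on_H4: "continuous_on {0..1/2} H4"
proof -
  have "continuous_on {0..1/2} (\<lambda>y. integral {0..y} H4_integrand)"
    by (intro indefinite_integral_continuous_1 integrable_H4_integrand) auto
  then show ?thesis by (rule continuous_on_eq) (auto simp: H4_eq)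
qed

lemma has_real_derivative_H4:
  assumes "0 < y" "y < 1/2"
  shows "(H4 has_real_derivative H4_integrand y) (at y)"
proof -
  have "isCont H4_integrand y"
    using assms by (intro continuous_on_interior[OF continuous_on_H4_integrand]) auto
  then have "((\<lambda>y. integral {0..y} H4_integrand) has_vector_derivative H4_integrand y) (at y within {0..1/2})"
    using assms integral_has_vector_derivative_continuous_at[of H4_integrand 0 "1/2" y "{}"]
      integrable_H4_integrand[of "1/2"] by (simp add: continuous_at_imp_continuous_at_within)
  also have "at y within {0..1/2} = at y"
    using assms by (intro at_within_interior) auto
  finally have "((\<lambda>y. integral {0..y} H4_integrand) has_real_derivative H4_integrand y) (at y)"
    by (simp add: has_real_derivative_iff_has_vector_derivative)
  then show ?thesis
    by (rule has_field_derivative_transform_within_open[of _ _ _ "{0<..<1/2}"]) (use assms in \<open>auto simp: H4_eq\<close>)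
qed

text \<open>The derivatives telescope: the Li_3, Li_2 and Li_1 terms cancel between consecutive
  summands, leaving only those from differentiating Li_1(-y) and log(y)^4. The auxiliary fact
  \<open>gen\<close> isolates this cancellation for arbitrary functions with the same chain of
  derivatives.\<close>

lemma has_real_derivative_E4:
  assumes "0 < y" "y < 1"
  shows "(E4 has_real_derivative 1 / 2 * (ln y) ^ 3 / (y * (1 + y))) (at y)"
proof -
  have gen: "((\<lambda>y. k - 3 * f4 y + 3 * f3 y * l y - 3 / 2 * f2 y * (l y) ^ 2 + 1 / 2 * f1 y * (l y) ^ 3 + 1 / 8 * (l y) ^ 4)
      has_real_derivative 1 / 2 * d * (l y) ^ 3 + 1 / 2 * (l y) ^ 3 / y) (at y)"
    if "(f4 has_real_derivative f3 y / y) (at y)" "(f3 has_real_derivative f2 y / y) (at y)"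
      "(f2 has_real_derivative f1 y / y) (at y)" "(f1 has_real_derivative d) (at y)"
      "(l has_real_derivative 1 / y) (at y)"
    for k d and f1 f2 f3 f4 l :: "real \<Rightarrow> real"
    by (rule derivative_eq_intros that refl | simp)+
  have Li: "((\<lambda>y. Li 4 (- y)) has_real_derivative Li 3 (- y) / y) (at y)"
    "((\<lambda>y. Li 3 (- y)) has_real_derivative Li 2 (- y) / y) (at y)"
    "((\<lambda>y. Li 2 (- y)) has_real_derivative Li 1 (- y) / y) (at y)"
    using assms by (auto intro!: derivative_eq_intros)
  have Li1: "((\<lambda>y. Li 1 (- y)) has_real_derivative - (1 / (1 + y))) (at y)"
  proof -
    have "((\<lambda>y. - ln (1 + y)) has_real_derivative - (1 / (1 + y))) (at y)"
      using assms by (auto intro!: derivative_eq_intros)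
    then show ?thesis
      by (rule has_field_derivative_transform_within_open[of _ _ _ "{0<..<1}"])
        (use assms Li_1 in auto)
  qed
  have ln: "(ln has_real_derivative 1 / y) (at y)"
    using assms by (auto intro!: derivative_eq_intros)
  have "1 / 2 * (- (1 / (1 + y))) * (ln y) ^ 3 + 1 / 2 * (ln y) ^ 3 / y = 1 / 2 * (ln y) ^ 3 / (y * (1 + y))"
    using assms by (simp add: divide_simps) (simp add: algebra_simps)
  with gen[OF Li Li1 ln] show ?thesis unfolding E4_def[abs_def] by simp
qed

section \<open>Differentiating the whole formula\<close>

definition P4_formula :: "real \<Rightarrow> real" where
  "P4_formula u = P 3 (u - 1) * ln u + zeta_val 2 / 4 * (2 * Li 2 (1 - 1 / u) + (ln u)\<^sup>2)
     - E4 (1 / (u - 2)) - H4 (1 / (u - 2))"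

text \<open>The product rule for P_3(u-1) log(u) yields the desired term plus P_2(u-2) log(u)/(u-1),
  which the other terms must cancel. Since u = (1+2y)/y, one has log(y/(1+2y)) = -log u and
  log(1+2y) = log u + log y, while dy/du = -y^2 turns the common factor 1/(y(1+y)) into
  -1/(u-1).\<close>

lemma has_real_derivative_P4_formula:
  assumes u: "u > 4"
  shows "(P4_formula has_real_derivative P 3 (u - 1) / u) (at u)"
proof -
  define y where "y = 1 / (u - 2)"
  have y: "0 < y" "y < 1/2" using u by (auto simp: y_def field_simps)
  have uy: "u = (1 + 2 * y) / y" using u by (simp add: y_def field_simps)
  have P3: "(P 3 has_real_derivative P 2 (u - 2) / (u - 1)) (at (u - 1))"
    using has_real_derivative_P[of 2 "u - 1"] u by (simp add: eval_nat_numeral del: P.simps)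
  have yd: "((\<lambda>u. 1 / (u - 2)) has_real_derivative - y\<^sup>2) (at u)"
    using u by (auto intro!: derivative_eq_intros simp: y_def field_simps power2_eq_square)
  have "((\<lambda>u. P 3 (u - 1) * ln u) has_real_derivative P 2 (u - 2) / (u - 1) * ln u + P 3 (u - 1) / u) (at u)"
    using u P3 by (auto intro!: derivative_eq_intros DERIV_chain2[of "P 3"] simp del: P.simps)
  \<comment> \<open>Multiplied by zeta_2/4, this derivative cancels the contribution of the constant
    -zeta_2/2 in P_2(u-2).\<close>
  moreover have "((\<lambda>u. 2 * Li 2 (1 - 1 / u) + (ln u)\<^sup>2) has_real_derivative 2 * ln u / (u - 1)) (at u)"
  proof -
    have "((\<lambda>u. 2 * Li 2 (1 - 1 / u) + (ln u)\<^sup>2) has_real_derivative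
       2 * (Li 1 (1 - 1 / u) / (1 - 1 / u) * (1 / u\<^sup>2)) + 2 * ln u / u) (at u)"
      using u by (auto intro!: derivative_eq_intros simp: power2_eq_square)
    also have "Li 1 (1 - 1 / u) = ln u"
      using u Li_1[of "1 - 1 / u"] by (simp add: ln_div)
    also have "2 * (ln u / (1 - 1 / u) * (1 / u\<^sup>2)) + 2 * ln u / u = 2 * ln u / (u - 1)"
      using u by (simp add: divide_simps power2_eq_square) (simp add: algebra_simps)
    finally show ?thesis .
  qed
  moreover have "((\<lambda>u. E4 (1 / (u - 2))) has_real_derivative 1 / 2 * (ln y) ^ 3 / (y * (1 + y)) * (- y\<^sup>2)) (at u)"
    using has_real_derivative_E4[of y] y unfolding y_def by (intro DERIV_chain2[OF _ yd[unfolded y_def]]) auto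
  moreover have "((\<lambda>u. H4 (1 / (u - 2))) has_real_derivative H4_integrand y * (- y\<^sup>2)) (at u)"
    using has_real_derivative_H4[of y] y unfolding y_def by (intro DERIV_chain2[OF _ yd[unfolded y_def]]) auto
  ultimately have "(P4_formula has_real_derivative
      (P 2 (u - 2) / (u - 1) * ln u + P 3 (u - 1) / u) + zeta_val 2 / 4 * (2 * ln u / (u - 1))
      - 1 / 2 * (ln y) ^ 3 / (y * (1 + y)) * (- y\<^sup>2) - H4_integrand y * (- y\<^sup>2)) (at u)"
    unfolding P4_formula_def[abs_def] by (intro DERIV_diff DERIV_add DERIV_cmult)
  also have "(P 2 (u - 2) / (u - 1) * ln u + P 3 (u - 1) / u) + zeta_val 2 / 4 * (2 * ln u / (u - 1))
      - 1 / 2 * (ln y) ^ 3 / (y * (1 + y)) * (- y\<^sup>2) - H4_integrand y * (- y\<^sup>2) = P 3 (u - 1) / u"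
  proof -
    have lnu: "ln u = ln (1 + 2 * y) - ln y" unfolding uy using y by (simp add: ln_div)
    have u1: "1 / (u - 1) = y / (1 + y)" unfolding uy using y by (simp add: field_simps)
    have P2: "P 2 (u - 2) = (ln y)\<^sup>2 / 2 + Li 2 y - zeta_val 2 / 2"
      using P_2[of "u - 2"] u by (simp add: y_def ln_div)
    \<comment> \<open>The whole cancellation, as a polynomial identity in \<open>ln y\<close>,
      \<open>ln u\<close> and \<open>Li 2 y\<close>.\<close>
    have bracket: "(P 2 (u - 2) + zeta_val 2 / 2) * ln u
        + (1 / 2 * (ln y) ^ 3 + (- ln u * Li 2 y - 1 / 2 * (ln y)\<^sup>2 * (ln u + ln y))) = 0"
      unfolding P2 by (simp add: algebra_simps power2_eq_square power3_eq_cube add_divide_distrib)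
    have r: "y\<^sup>2 / (y * (1 + y)) = 1 / (u - 1)"
      using y by (simp add: u1 power2_eq_square)
    have H: "H4_integrand y = (- ln u * Li 2 y - 1 / 2 * (ln y)\<^sup>2 * (ln u + ln y)) / (y * (1 + y))"
      unfolding H4_integrand_def using y by (simp add: lnu ln_div)
    have "(P 2 (u - 2) / (u - 1) * ln u + P 3 (u - 1) / u) + zeta_val 2 / 4 * (2 * ln u / (u - 1))
      - 1 / 2 * (ln y) ^ 3 / (y * (1 + y)) * (- y\<^sup>2) - a / (y * (1 + y)) * (- y\<^sup>2)
      = P 3 (u - 1) / u + ((P 2 (u - 2) + zeta_val 2 / 2) * ln u * (1 / (u - 1))
      + (1 / 2 * (ln y) ^ 3 + a) * (y\<^sup>2 / (y * (1 + y))))" for a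
      by (simp add: algebra_simps add_divide_distrib)
    then show ?thesis
      unfolding H r by (simp only: bracket mult_zero_left add_0_right flip: distrib_right)
  qed
  finally show ?thesis .
qed

lemma continuous_on_P4_formula: "continuous_on {4..} P4_formula"
proof -
  have Li: "continuous_on {-1..1} (Li 2)" by (rule continuous_on_Li) auto
  have E: "continuous_on {0<..1/2} E4"
    by (rule DERIV_continuous_on[OF has_field_derivative_at_within[OF has_real_derivative_E4]]) auto
  show ?thesis unfolding P4_formula_def
    by (intro continuous_intros continuous_on_compose2[OF continuous_on_P[of 3]]
        continuous_on_compose2[OF Li] continuous_on_compose2[OF E] continuous_on_compose2[OF continuous_on_H4])
      (auto simp: field_simps)
qed

text \<open>The derivatives agree only for u > 4, as y = 1/2 is the endpoint for \<open>H4\<close>;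
  continuity extends the constancy to u = 4.\<close>

lemma P_4_minus_formula_const:
  assumes "u \<ge> 4"
  shows "P 4 u - P4_formula u = P 4 4 - P4_formula 4"
proof (cases "u = 4")
  case False
  show ?thesis
  proof (rule DERIV_isconst_end[where f = "\<lambda>u. P 4 u - P4_formula u"])
    show "4 < u" using assms False by simp
    show "continuous_on {4..u} (\<lambda>u. P 4 u - P4_formula u)"
      using continuous_on_P[of 4]
      by (intro continuous_intros continuous_on_subset[OF continuous_on_P4_formula]) (auto intro: continuous_on_subset simp del: P.simps)
    fix x :: real assume x: "4 < x" "x < u"
    have "(P 4 has_real_derivative P 3 (x - 1) / x) (at x)"
      using has_real_derivative_P[of 3 x] x by (simp add: eval_nat_numeral del: P.simps)
    from DERIV_diff[OF this has_real_derivative_P4_formula] x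
    show "((\<lambda>u. P 4 u - P4_formula u) has_real_derivative 0) (at x)" by simp
  qed
qed auto

section \<open>The constant of integration\<close>

text \<open>The main terms integrate (log(u)^2 - zeta_2)/(2u). Replacing u - 1 by u and dropping
  Li_2(1/(u-1)) in the derivative costs O(u^(-3/2)), so the difference converges. Its limit
  \<open>c\<close> is left unspecified: it affects only the coefficient of log u in the expansion of
  \<open>P 4\<close>.\<close>

lemma P_3_asymptotic:
  obtains c where "\<And>u. u \<ge> 4 \<Longrightarrow>
    \<bar>P 3 u - ((ln u) ^ 3 / 6 - zeta_val 2 / 2 * ln u + c)\<bar> \<le> 16 * u powr (-1/2)"
proof -
  let ?f = "\<lambda>u. P 3 u - ((ln u) ^ 3 / 6 - zeta_val 2 / 2 * ln u)"
  let ?d = "\<lambda>u. (((ln (u - 1))\<^sup>2 - (ln u)\<^sup>2) / 2 + Li 2 (1 / (u - 1))) / u"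
  have f: "(?f has_real_derivative ?d u) (at u)" if u: "u \<ge> 4" for u
  proof -
    have P3: "(P 3 has_real_derivative P 2 (u - 1) / u) (at u)"
      using has_real_derivative_P[of 2 u] u by (simp add: eval_nat_numeral del: P.simps)
    have "((\<lambda>u. (ln u) ^ 3 / 6 - zeta_val 2 / 2 * ln u) has_real_derivative
        (ln u)\<^sup>2 / 2 / u - zeta_val 2 / 2 / u) (at u)"
      using u by (auto intro!: derivative_eq_intros)
    from DERIV_diff[OF P3 this] show ?thesis
      using P_2[of "u - 1"] u by (simp add: diff_divide_distrib add_divide_distrib algebra_simps)
  qed
  have d: "\<bar>?d u\<bar> \<le> 8 * u powr (-3/2)" if u: "u \<ge> 4" for u
  proof -
    \<comment> \<open>With w = sqrt(u), log u <= 2w and log u - log(u-1) <= 2/u bound the difference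
      of squares by 8/w; half of this plus 4/w for the dilogarithm is 8/w.\<close>
    define w where "w = u powr (1/2)"
    have w: "w \<ge> 1" and uw: "u = w * w"
      unfolding w_def using u by (auto simp: ge_one_powr_ge_zero simp flip: powr_add)
    have w3: "u powr (-3/2) = 1 / (w * u)"
      unfolding w_def using u powr_add[of u "1/2" 1] by (simp add: powr_minus field_simps)
    have "ln u = 2 * ln w" using w by (simp add: uw ln_mult)
    also have "\<dots> \<le> 2 * w" using ln_le_minus_one[of w] w by simp
    finally have lnu: "ln u \<le> 2 * w" .
    have mono: "0 \<le> ln (u - 1)" "ln (u - 1) \<le> ln u" using u by auto
    have "ln u - ln (u - 1) = ln (1 + 1 / (u - 1))"
    proof -
      have "1 + 1 / (u - 1) = u / (u - 1)" using u by (simp add: field_simps)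
      then show ?thesis using u by (simp add: ln_div)
    qed
    also have "\<dots> \<le> 1 / (u - 1)" using u by (intro ln_add_one_self_le_self) auto
    also have "\<dots> \<le> 2 / u" using u by (simp add: field_simps)
    finally have diff: "ln u - ln (u - 1) \<le> 2 / u" .
    have "\<bar>(ln (u - 1))\<^sup>2 - (ln u)\<^sup>2\<bar> = (ln u - ln (u - 1)) * (ln u + ln (u - 1))"
      using power_mono[OF mono(2,1), of 2] by (simp add: power2_eq_square algebra_simps)
    also have "\<dots> \<le> 2 / u * (2 * w + 2 * w)"
      using mono lnu order_trans[OF mono(2) lnu] diff u by (intro mult_mono add_mono) auto
    also have "\<dots> = 8 / w" using w by (simp add: uw field_simps)
    finally have 1: "\<bar>(ln (u - 1))\<^sup>2 - (ln u)\<^sup>2\<bar> \<le> 8 / w" .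
    have "\<bar>Li 2 (1 / (u - 1))\<bar> \<le> 2 * \<bar>1 / (u - 1)\<bar>" using u by (intro abs_Li_le) auto
    also have "\<dots> \<le> 4 / u" using u by (simp add: field_simps)
    also have "\<dots> \<le> 4 / w" using w by (simp add: uw field_simps)
    finally have 2: "\<bar>Li 2 (1 / (u - 1))\<bar> \<le> 4 / w" .
    have "\<bar>((ln (u - 1))\<^sup>2 - (ln u)\<^sup>2) / 2 + Li 2 (1 / (u - 1))\<bar> \<le> 8 / w"
      using 1 2 by (simp add: abs_le_iff field_simps)
    then have "\<bar>((ln (u - 1))\<^sup>2 - (ln u)\<^sup>2) / 2 + Li 2 (1 / (u - 1))\<bar> / u \<le> 8 / w / u"
      using u by (intro divide_right_mono) auto
    then show ?thesis unfolding w3 using u by (simp add: abs_divide)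
  qed
  obtain c where "\<And>u. u \<ge> 4 \<Longrightarrow> \<bar>?f u - c\<bar> \<le> 2 * 8 * u powr (-1/2)"
    by (rule limit_of_bounded_derivative[OF f d]) auto
  then show ?thesis by (intro that[of c]) (simp add: algebra_simps)
qed

lemma tendsto_Li_at_top:
  assumes "(g \<longlongrightarrow> 0) at_top" "((\<lambda>u. g u * h u) \<longlongrightarrow> 0) at_top"
  shows "((\<lambda>u::real. Li k (g u) * h u) \<longlongrightarrow> 0) at_top"
proof (rule Lim_null_comparison)
  show "((\<lambda>u. 2 * \<bar>g u * h u\<bar>) \<longlongrightarrow> 0) at_top"
    using tendsto_mult_right_zero[OF tendsto_rabs_zero[OF assms(2)]] by simp
  have "\<forall>\<^sub>F u in at_top. \<bar>g u\<bar> < 1/2"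
    using tendsto_rabs_zero[OF assms(1)] by (rule order_tendstoD) auto
  then show "\<forall>\<^sub>F u in at_top. norm (Li k (g u) * h u) \<le> 2 * \<bar>g u * h u\<bar>"
  proof eventually_elim
    case (elim u)
    then have "\<bar>Li k (g u)\<bar> * \<bar>h u\<bar> \<le> 2 * \<bar>g u\<bar> * \<bar>h u\<bar>"
      by (intro mult_right_mono abs_Li_le) auto
    then show ?case by (simp add: abs_mult)
  qed
qed

text \<open>Each polylogarithm is O(y), which beats every power of log y; only the constant and
  log(y)^4/8 survive.\<close>

lemma tendsto_E4:
  "((\<lambda>u. E4 (1 / (u - 2)) - (ln u) ^ 4 / 8) \<longlongrightarrow> 19 / 16 * zeta_val 4) at_top"
proof -
  let ?y = "\<lambda>u::real. 1 / (u - 2)"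
  have Li: "((\<lambda>u. Li k (- ?y u) * ln (?y u) ^ j) \<longlongrightarrow> 0) at_top"
    if "((\<lambda>u. - ?y u * ln (?y u) ^ j) \<longlongrightarrow> 0) at_top" for k j
    using that by (intro tendsto_Li_at_top) real_asymp+
  have "((\<lambda>u. - ?y u * ln (?y u) ^ 0) \<longlongrightarrow> 0) at_top" by real_asymp
  moreover have "((\<lambda>u. - ?y u * ln (?y u) ^ 1) \<longlongrightarrow> 0) at_top" by real_asymp
  moreover have "((\<lambda>u. - ?y u * ln (?y u) ^ 2) \<longlongrightarrow> 0) at_top" by real_asymp
  moreover have "((\<lambda>u. - ?y u * ln (?y u) ^ 3) \<longlongrightarrow> 0) at_top" by real_asymp
  moreover have "((\<lambda>u::real. 1 / 8 * ln (?y u) ^ 4 - (ln u) ^ 4 / 8) \<longlongrightarrow> 0) at_top" by real_asymp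
  ultimately have "((\<lambda>u. 19 / 16 * zeta_val 4 - 3 * (Li 4 (- ?y u) * ln (?y u) ^ 0)
      + 3 * (Li 3 (- ?y u) * ln (?y u) ^ 1) - 3 / 2 * (Li 2 (- ?y u) * ln (?y u) ^ 2)
      + 1 / 2 * (Li 1 (- ?y u) * ln (?y u) ^ 3) + (1 / 8 * ln (?y u) ^ 4 - (ln u) ^ 4 / 8))
    \<longlongrightarrow> 19 / 16 * zeta_val 4 - 3 * 0 + 3 * 0 - 3 / 2 * 0 + 1 / 2 * 0 + 0) at_top"
    by (intro tendsto_add tendsto_diff tendsto_mult tendsto_const Li)
  then show ?thesis by (simp add: E4_def algebra_simps)
qed

lemma tendsto_H4: "((\<lambda>u. H4 (1 / (u - 2))) \<longlongrightarrow> 0) at_top"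
proof (rule Lim_null_comparison)
  show "\<forall>\<^sub>F u in at_top. norm (H4 (1 / (u - 2))) \<le> 52 * (1 / (u - 2)) powr (1/2)"
    using eventually_ge_at_top[of 4]
    by eventually_elim (use abs_H4_le in \<open>simp add: field_simps\<close>)
  show "((\<lambda>u::real. 52 * (1 / (u - 2)) powr (1/2)) \<longlongrightarrow> 0) at_top" by real_asymp
qed

lemma tendsto_Li_2_zeta: "((\<lambda>u. Li 2 (1 - 1 / u)) \<longlongrightarrow> zeta_val 2) at_top"
proof -
  have "(Li 2 \<longlongrightarrow> Li 2 1) (at 1 within {-1..1})"
    using continuous_on_Li[of 2] by (auto simp: continuous_on_def)
  moreover have "filterlim (\<lambda>u::real. 1 - 1 / u) (at 1 within {-1..1}) at_top"
    unfolding filterlim_at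
  proof
    show "\<forall>\<^sub>F u::real in at_top. 1 - 1 / u \<in> {-1..1} \<and> 1 - 1 / u \<noteq> 1"
      using eventually_ge_at_top[of 1] by eventually_elim (auto simp: field_simps)
    show "((\<lambda>u::real. 1 - 1 / u) \<longlongrightarrow> 1) at_top" by real_asymp
  qed
  ultimately show ?thesis unfolding zeta_val_def by (rule filterlim_compose)
qed

text \<open>The log^4 coefficient is 1/6 - 1/8 = 1/24, from P_3(u-1) log u and \<open>E4\<close>;
  that of log^2 is -zeta_2/2 + zeta_2/4. The constant collects zeta_2^2/2 from Li_2(1), the constant
  of \<open>E4\<close>, and the unknown difference at 4.\<close>

lemma P_4_asymptotic:
  obtains c where "((\<lambda>u. P 4 u - ((ln u) ^ 4 / 24 - zeta_val 2 / 4 * (ln u)\<^sup>2 + c * ln u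
      + ((zeta_val 2)\<^sup>2 / 2 - 19 / 16 * zeta_val 4 + (P 4 4 - P4_formula 4)))) \<longlongrightarrow> 0) at_top"
proof -
  obtain c where c: "\<And>u. u \<ge> 4 \<Longrightarrow>
      \<bar>P 3 u - ((ln u) ^ 3 / 6 - zeta_val 2 / 2 * ln u + c)\<bar> \<le> 16 * u powr (-1/2)"
    by (rule P_3_asymptotic) blast
  let ?K = "P 4 4 - P4_formula 4" and ?z = "zeta_val 2"
  let ?e = "\<lambda>u. P 3 (u - 1) - ((ln (u - 1)) ^ 3 / 6 - ?z / 2 * ln (u - 1) + c)"
  have e: "((\<lambda>u. ?e u * ln u) \<longlongrightarrow> 0) at_top"
  proof (rule Lim_null_comparison)
    show "\<forall>\<^sub>F u in at_top. norm (?e u * ln u) \<le> 16 * (u - 1) powr (-1/2) * ln u"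
      using eventually_ge_at_top[of 5]
    proof eventually_elim
      case (elim u)
      then have "\<bar>?e u\<bar> * \<bar>ln u\<bar> \<le> 16 * (u - 1) powr (-1/2) * \<bar>ln u\<bar>"
        by (intro mult_right_mono c) auto
      with elim show ?case by (simp add: abs_mult del: P.simps)
    qed
    show "((\<lambda>u::real. 16 * (u - 1) powr (-1/2) * ln u) \<longlongrightarrow> 0) at_top" by real_asymp
  qed
  have "((\<lambda>u::real. ((ln (u - 1)) ^ 3 - (ln u) ^ 3) * ln u) \<longlongrightarrow> 0) at_top"
    and "((\<lambda>u::real. (ln (u - 1) - ln u) * ln u) \<longlongrightarrow> 0) at_top"
    by real_asymp+
  with e have "((\<lambda>u. ?e u * ln u + 1 / 6 * (((ln (u - 1)) ^ 3 - (ln u) ^ 3) * ln u)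
      - ?z / 2 * ((ln (u - 1) - ln u) * ln u) + ?z / 2 * Li 2 (1 - 1 / u)
      - (E4 (1 / (u - 2)) - (ln u) ^ 4 / 8) - H4 (1 / (u - 2)) - (?z\<^sup>2 / 2 - 19 / 16 * zeta_val 4))
    \<longlongrightarrow> 0 + 1 / 6 * 0 - ?z / 2 * 0 + ?z / 2 * ?z - 19 / 16 * zeta_val 4 - 0
      - (?z\<^sup>2 / 2 - 19 / 16 * zeta_val 4)) at_top"
    by (intro tendsto_add tendsto_diff tendsto_mult tendsto_const tendsto_E4 tendsto_H4 tendsto_Li_2_zeta)
  then have lim: "((\<lambda>u. ?e u * ln u + 1 / 6 * (((ln (u - 1)) ^ 3 - (ln u) ^ 3) * ln u)
      - ?z / 2 * ((ln (u - 1) - ln u) * ln u) + ?z / 2 * Li 2 (1 - 1 / u)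
      - (E4 (1 / (u - 2)) - (ln u) ^ 4 / 8) - H4 (1 / (u - 2)) - (?z\<^sup>2 / 2 - 19 / 16 * zeta_val 4))
    \<longlongrightarrow> 0) at_top"
    by (simp add: power2_eq_square del: P.simps)
  show ?thesis
  proof (rule that[of c], rule Lim_transform_eventually[OF lim])
    show "\<forall>\<^sub>F u in at_top. ?e u * ln u + 1 / 6 * (((ln (u - 1)) ^ 3 - (ln u) ^ 3) * ln u)
      - ?z / 2 * ((ln (u - 1) - ln u) * ln u) + ?z / 2 * Li 2 (1 - 1 / u)
      - (E4 (1 / (u - 2)) - (ln u) ^ 4 / 8) - H4 (1 / (u - 2)) - (?z\<^sup>2 / 2 - 19 / 16 * zeta_val 4)
      = P 4 u - ((ln u) ^ 4 / 24 - ?z / 4 * (ln u)\<^sup>2 + c * ln u + (?z\<^sup>2 / 2 - 19 / 16 * zeta_val 4 + ?K))"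
      using eventually_ge_at_top[of 4]
    proof eventually_elim
      case (elim u)
      have "P 4 u = P4_formula u + ?K" using P_4_minus_formula_const[OF elim] by linarith
      then show ?case
        unfolding P4_formula_def[of u]
        by (simp add: algebra_simps power2_eq_square power3_eq_cube power4_eq_xxxx del: P.simps)
    qed
  qed
qed

section \<open>Averages under the exponential distribution\<close>

lemma has_bochner_integral_exp_measure_P:
  assumes E: "\<And>s. s > 0 \<Longrightarrow> (E has_real_derivative - (exp (- s) / s)) (at s)"
    and lim: "(E \<longlongrightarrow> 0) at_top" and N: "N > 0" and k: "k > 0"
  shows "has_bochner_integral exp_measure (\<lambda>t. P k (N * t)) (E (1 / N) ^ k / fact k)"
proof -
  have [measurable]: "(\<lambda>t. P k (N * t)) \<in> borel_measurable borel" by measurable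
  have "(\<integral>\<^sup>+t. ennreal (P k (N * t)) \<partial>exp_measure)
      = (\<integral>\<^sup>+t. ennreal N * ennreal (1 / N * exp (- (1 / N) * (0 + N * t)) * P k (0 + N * t)) \<partial>lborel)"
  proof (subst nn_integral_exp_measure, measurable, rule nn_integral_cong)
    fix t :: real
    \<comment> \<open>Here k > 0 matters: it lets the integral over positive t be extended to the
      whole line, where u = N t turns it into the transform at s = 1/N.\<close>
    have "P k (N * t) = 0" if "t \<le> 0"
    proof (rule P_eq_0)
      have "N * t \<le> 0" using that N by (simp add: mult_le_0_iff)
      then show "N * t < real k" using k by simp
    qed
    then show "ennreal (indicator {0<..} t * exp (- t)) * ennreal (P k (N * t))
      = ennreal N * ennreal (1 / N * exp (- (1 / N) * (0 + N * t)) * P k (0 + N * t))"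
      using N by (cases "t \<le> 0") (simp_all add: ennreal_mult[symmetric] P_nonneg)
  qed
  also have "\<dots> = ennreal \<bar>N\<bar> * (\<integral>\<^sup>+t. ennreal (1 / N * exp (- (1 / N) * (0 + N * t)) * P k (0 + N * t)) \<partial>lborel)"
    using N by (subst nn_integral_cmult) auto
  also have "\<dots> = (\<integral>\<^sup>+u. ennreal (1 / N * exp (- (1 / N) * u) * P k u) \<partial>lborel)"
    using N by (intro nn_integral_real_affine[symmetric]) auto
  also have "\<dots> = ennreal (E (1 / N) ^ k / fact k)"
    using N by (intro nn_integral_P_exp[OF E lim]) auto
  finally have eq: "(\<integral>\<^sup>+t. ennreal (P k (N * t)) \<partial>exp_measure) = ennreal (E (1 / N) ^ k / fact k)" .
  have "0 \<le> E (1 / N) ^ k / fact k"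
    using N exponential_integral_nonneg[OF E lim, of "1 / N"] by simp
  from has_bochner_integral_nn_integral[OF _ _ this eq] show ?thesis
    by (simp add: P_nonneg)
qed

abbreviation quartic :: "real \<Rightarrow> real \<Rightarrow> real \<Rightarrow> real \<Rightarrow> real" where
  "quartic a c d z \<equiv> z ^ 4 / 24 + a * z\<^sup>2 + c * z + d"

text \<open>\<open>power_div_fact_bound\<close> at \<open>ln u\<close> controls the logarithm near 0
  and near infinity at once; the numbers 16, 8, 2, 1 are n! 2^n, divided by 24 in the leading
  case.\<close>

lemma quartic_ln_bound:
  obtains B where "B \<ge> 0" "\<And>u. u > 0 \<Longrightarrow> \<bar>quartic a c d (ln u)\<bar> \<le> B * (u powr (1/2) + u powr (-1/2))"
proof (rule that)
  let ?B = "16 + \<bar>a\<bar> * 8 + \<bar>c\<bar> * 2 + \<bar>d\<bar>"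
  show "?B \<ge> 0" by simp
  fix u :: real assume u: "u > 0"
  let ?l = "ln u" and ?W = "u powr (1/2) + u powr (-1/2)"
  have W: "\<bar>?l ^ n\<bar> \<le> fact n * 2 ^ n * ?W" for n
    using power_div_fact_bound[of ?l n] u by (simp add: powr_def field_simps)
  have "\<bar>quartic a c d ?l\<bar> \<le> \<bar>?l ^ 4\<bar> / 24 + \<bar>a\<bar> * \<bar>?l\<^sup>2\<bar> + \<bar>c\<bar> * \<bar>?l ^ 1\<bar> + \<bar>d\<bar> * \<bar>?l ^ 0\<bar>"
  proof -
    have "\<bar>w + x + y + z\<bar> \<le> \<bar>w\<bar> + \<bar>x\<bar> + \<bar>y\<bar> + \<bar>z\<bar>" for w x y z :: real by linarith
    from this[of "?l ^ 4 / 24" "a * ?l\<^sup>2" "c * ?l" d] show ?thesis by (simp add: abs_mult)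
  qed
  also have "\<dots> \<le> (fact 4 * 2 ^ 4 * ?W) / 24 + \<bar>a\<bar> * (fact 2 * 2\<^sup>2 * ?W) + \<bar>c\<bar> * (fact 1 * 2 ^ 1 * ?W)
      + \<bar>d\<bar> * (fact 0 * 2 ^ 0 * ?W)"
    by (intro add_mono mult_left_mono divide_right_mono W) auto
  also have "\<dots> = ?B * ?W" by (simp add: fact_numeral algebra_simps)
  finally show "\<bar>quartic a c d ?l\<bar> \<le> ?B * ?W" .
qed

text \<open>As log(Nt) = \<open>ln_centred t\<close> + l, the quartic is expanded about l and each
  power replaced by its moment; the linear term drops out.\<close>

lemma has_bochner_integral_quartic_ln:
  fixes N :: real
  assumes N: "N > 0"
  defines "l \<equiv> ln N - euler_mascheroni"
  shows "has_bochner_integral exp_measure (\<lambda>t. quartic a c d (ln (N * t)))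
    (ln_moment 4 / 24 + ln_moment 3 * l / 6 + zeta_val 2 * (l\<^sup>2 / 4 + a) + quartic a c d l)"
proof -
  have m: "has_bochner_integral exp_measure (\<lambda>t. ln_centred t ^ n) (ln_moment n)" for n
    using integrable_ln_centred_power by (simp add: has_bochner_integral_iff ln_moment_def)
  have "has_bochner_integral exp_measure
    (\<lambda>t. ln_centred t ^ 4 * (1 / 24) + ln_centred t ^ 3 * (l / 6) + ln_centred t ^ 2 * (l\<^sup>2 / 4 + a)
      + ln_centred t ^ 1 * (l ^ 3 / 6 + 2 * a * l + c) + ln_centred t ^ 0 * quartic a c d l)
    (ln_moment 4 * (1 / 24) + ln_moment 3 * (l / 6) + ln_moment 2 * (l\<^sup>2 / 4 + a)
      + ln_moment 1 * (l ^ 3 / 6 + 2 * a * l + c) + ln_moment 0 * quartic a c d l)"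
    by (intro has_bochner_integral_add has_bochner_integral_mult_left m)
  also have "?this \<longleftrightarrow> has_bochner_integral exp_measure (\<lambda>t. quartic a c d (ln (N * t)))
    (ln_moment 4 * (1 / 24) + ln_moment 3 * (l / 6) + ln_moment 2 * (l\<^sup>2 / 4 + a)
      + ln_moment 1 * (l ^ 3 / 6 + 2 * a * l + c) + ln_moment 0 * quartic a c d l)"
  proof (intro has_bochner_integral_cong_AE)
    have expand: "x ^ 4 * (1 / 24) + x ^ 3 * (l / 6) + x ^ 2 * (l\<^sup>2 / 4 + a)
      + x ^ 1 * (l ^ 3 / 6 + 2 * a * l + c) + x ^ 0 * quartic a c d l = quartic a c d (x + l)" for x
      by (simp add: field_simps power2_eq_square power3_eq_cube power4_eq_xxxx)
    show "AE t in exp_measure. ln_centred t ^ 4 * (1 / 24) + ln_centred t ^ 3 * (l / 6)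
        + ln_centred t ^ 2 * (l\<^sup>2 / 4 + a) + ln_centred t ^ 1 * (l ^ 3 / 6 + 2 * a * l + c)
        + ln_centred t ^ 0 * quartic a c d l = quartic a c d (ln (N * t))"
      using AE_exp_measure_pos
    proof eventually_elim
      case (elim t)
      have "ln_centred t + l = ln (N * t)" using elim N by (simp add: l_def ln_mult)
      then show ?case unfolding expand by (simp only:)
    qed
  qed auto
  finally show ?thesis by (simp add: ln_moment_0 ln_moment_1[simplified] ln_moment_2)
qed

text \<open>Both numbers are means: E(1/N) of P_1(Nt), and log N - gamma of log(Nt). The two
  integrands agree where Nt >= 1, and elsewhere |log v| <= 2 v^(-1/2), whose mean is a Gamma
  value.\<close>

lemma exponential_integral_approx:
  fixes N :: real
  assumes E: "\<And>s. s > 0 \<Longrightarrow> (E has_real_derivative - (exp (- s) / s)) (at s)"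
    and lim: "(E \<longlongrightarrow> 0) at_top" and N: "N > 0"
  shows "\<bar>E (1 / N) - (ln N - euler_mascheroni)\<bar> \<le> 2 * Gamma (1 / 2) * N powr (-1/2)"
proof -
  have P: "has_bochner_integral exp_measure (\<lambda>t. P 1 (N * t)) (E (1 / N))"
    using has_bochner_integral_exp_measure_P[OF E lim N, of 1] by (simp del: P.simps)
  have "has_bochner_integral exp_measure (\<lambda>t. ln_centred t ^ 1 + ln_centred t ^ 0 * (ln N - euler_mascheroni))
      (ln_moment 1 + ln_moment 0 * (ln N - euler_mascheroni))"
    using integrable_ln_centred_power
    by (intro has_bochner_integral_add has_bochner_integral_mult_left)
      (auto simp only: has_bochner_integral_iff ln_moment_def)
  also have "?this \<longleftrightarrow> has_bochner_integral exp_measure (\<lambda>t. ln (N * t))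
      (ln_moment 1 + ln_moment 0 * (ln N - euler_mascheroni))"
  proof (intro has_bochner_integral_cong_AE)
    show "AE t in exp_measure. ln_centred t ^ 1 + ln_centred t ^ 0 * (ln N - euler_mascheroni) = ln (N * t)"
      using AE_exp_measure_pos by eventually_elim (use N in \<open>simp add: ln_mult\<close>)
  qed auto
  finally have L: "has_bochner_integral exp_measure (\<lambda>t. ln (N * t)) (ln N - euler_mascheroni)"
    by (simp add: ln_moment_0 ln_moment_1[simplified])
  have W: "has_bochner_integral exp_measure (\<lambda>t. 2 * N powr (-1/2) * t powr (-1/2)) (2 * N powr (-1/2) * Gamma (1 + -1/2))"
    by (intro has_bochner_integral_mult_right has_bochner_integral_exp_measure_powr) auto
  note D = has_bochner_integral_diff[OF P L]
  have "\<bar>E (1 / N) - (ln N - euler_mascheroni)\<bar> = \<bar>\<integral>t. P 1 (N * t) - ln (N * t) \<partial>exp_measure\<bar>"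
    using D by (simp only: has_bochner_integral_iff)
  also have "\<dots> \<le> (\<integral>t. \<bar>P 1 (N * t) - ln (N * t)\<bar> \<partial>exp_measure)"
    by (rule integral_abs_bound)
  also have "\<dots> \<le> (\<integral>t. 2 * N powr (-1/2) * t powr (-1/2) \<partial>exp_measure)"
  proof (rule integral_mono_AE)
    show "AE t in exp_measure. \<bar>P 1 (N * t) - ln (N * t)\<bar> \<le> 2 * N powr (-1/2) * t powr (-1/2)"
      using AE_exp_measure_pos
    proof eventually_elim
      case (elim t)
      define v where "v = N * t"
      have v: "v > 0" using elim N by (simp add: v_def)
      have "\<bar>P 1 v - ln v\<bar> \<le> 2 * v powr (-1/2)"
      proof (cases "v \<ge> 1")
        case True
        then show ?thesis by (simp add: P_1 del: P.simps One_nat_def)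
      next
        case False
        have "- ln v / 2 \<le> v powr (-1/2) - 1"
          using ln_le_minus_one[of "v powr (-1/2)"] v by (simp add: ln_powr)
        then show ?thesis using False v P_eq_0[of v 1] by (simp del: P.simps One_nat_def)
      qed
      then show ?case using elim N by (simp add: v_def powr_mult mult_ac del: P.simps One_nat_def)
    qed
  qed (use D W in \<open>auto simp: has_bochner_integral_iff simp del: P.simps One_nat_def\<close>)
  also have "\<dots> = 2 * Gamma (1 / 2) * N powr (-1/2)"
    using W by (simp add: has_bochner_integral_iff)
  finally show ?thesis .
qed

lemma affine_tendsto_0_imp:
  fixes l :: "nat \<Rightarrow> real"
  assumes l: "filterlim l at_top sequentially" and lim: "(\<lambda>n. p * l n + q) \<longlonglongrightarrow> 0"
  shows "p = 0" "q = 0"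
proof -
  have inv: "(\<lambda>n. inverse (l n)) \<longlonglongrightarrow> 0"
    by (rule tendsto_inverse_0_at_top[OF l])
  have "(\<lambda>n. (p * l n + q) * inverse (l n) - q * inverse (l n)) \<longlonglongrightarrow> 0 * 0 - q * 0"
    by (intro tendsto_intros lim inv)
  moreover have "\<forall>\<^sub>F n in sequentially. (p * l n + q) * inverse (l n) - q * inverse (l n) = p"
    using filterlim_at_top_dense[THEN iffD1, OF l, rule_format, of 0]
    by eventually_elim (simp add: field_simps)
  ultimately have "(\<lambda>n. p) \<longlonglongrightarrow> 0"
    by (simp add: tendsto_cong)
  then show "p = 0" by (simp add: LIMSEQ_const_iff)
  with lim show "q = 0" by (simp add: LIMSEQ_const_iff)
qed

text \<open>Write E(1/N) = l + \<delta> with \<delta> = O(N^(-1/2)): each term of (l + \<delta>)^4 -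
  l^4 has a factor \<delta>, which beats powers of l.\<close>

lemma exponential_integral_power4_tendsto:
  assumes E: "\<And>s. s > 0 \<Longrightarrow> (E has_real_derivative - (exp (- s) / s)) (at s)"
    and lim: "(E \<longlongrightarrow> 0) at_top"
  defines "l \<equiv> \<lambda>n. ln (real (Suc n)) - euler_mascheroni"
  shows "(\<lambda>n. E (1 / real (Suc n)) ^ 4 - l n ^ 4) \<longlonglongrightarrow> 0"
proof -
  define \<delta> where "\<delta> = (\<lambda>n. E (1 / real (Suc n)) - l n)"
  have \<delta>: "(\<lambda>n. l n ^ j * \<delta> n) \<longlonglongrightarrow> 0" if j: "(\<lambda>n. l n ^ j * real (Suc n) powr (-1/2)) \<longlonglongrightarrow> 0" for j
  proof (rule Lim_null_comparison)
    show "(\<lambda>n. 2 * Gamma (1 / 2) * \<bar>l n ^ j * real (Suc n) powr (-1/2)\<bar>) \<longlonglongrightarrow> 0"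
      by (intro tendsto_mult_right_zero tendsto_rabs_zero j)
    have "\<bar>l n ^ j\<bar> * \<bar>\<delta> n\<bar> \<le> \<bar>l n ^ j\<bar> * (2 * Gamma (1 / 2) * real (Suc n) powr (-1/2))" for n
      unfolding \<delta>_def l_def by (intro mult_left_mono exponential_integral_approx[OF E lim]) auto
    then show "\<forall>\<^sub>F n in sequentially. norm (l n ^ j * \<delta> n) \<le> 2 * Gamma (1 / 2) * \<bar>l n ^ j * real (Suc n) powr (-1/2)\<bar>"
      by (intro always_eventually) (simp add: abs_mult mult_ac)
  qed
  have "(\<lambda>n. l n ^ 0 * real (Suc n) powr (-1/2)) \<longlonglongrightarrow> 0"
    "(\<lambda>n. l n ^ 1 * real (Suc n) powr (-1/2)) \<longlonglongrightarrow> 0"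
    "(\<lambda>n. l n ^ 2 * real (Suc n) powr (-1/2)) \<longlonglongrightarrow> 0"
    "(\<lambda>n. l n ^ 3 * real (Suc n) powr (-1/2)) \<longlonglongrightarrow> 0"
    unfolding l_def by real_asymp+
  note \<delta>s = this[THEN \<delta>]
  have "(\<lambda>n. 4 * (l n ^ 3 * \<delta> n) + 6 * (l n ^ 2 * \<delta> n) * (l n ^ 0 * \<delta> n)
      + 4 * (l n ^ 1 * \<delta> n) * (l n ^ 0 * \<delta> n) ^ 2 + (l n ^ 0 * \<delta> n) ^ 4)
    \<longlonglongrightarrow> 4 * 0 + 6 * 0 * 0 + 4 * 0 * 0 ^ 2 + 0 ^ 4"
    by (intro tendsto_add tendsto_mult tendsto_power tendsto_const \<delta>s)
  moreover have "4 * (l n ^ 3 * \<delta> n) + 6 * (l n ^ 2 * \<delta> n) * (l n ^ 0 * \<delta> n)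
      + 4 * (l n ^ 1 * \<delta> n) * (l n ^ 0 * \<delta> n) ^ 2 + (l n ^ 0 * \<delta> n) ^ 4
      = E (1 / real (Suc n)) ^ 4 - l n ^ 4" for n
  proof -
    have "4 * (x ^ 3 * d) + 6 * (x ^ 2 * d) * (x ^ 0 * d) + 4 * (x ^ 1 * d) * (x ^ 0 * d) ^ 2 + (x ^ 0 * d) ^ 4
      = (d + x) ^ 4 - x ^ 4" for x d :: real
      by (simp add: algebra_simps power2_eq_square power3_eq_cube power4_eq_xxxx)
    then show ?thesis by (simp only: \<delta>_def diff_add_cancel)
  qed
  ultimately show ?thesis by simp
qed

text \<open>Dominated convergence. The remainder is below 1 beyond some V; before V,
  \<open>P 4\<close> is bounded by compactness and the quartic by \<open>quartic_ln_bound\<close>.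
  So it is O(1 + u^(-1/2)), and scaling u by \<open>Suc n\<close> >= 1 only lowers this
  majorant.\<close>

lemma P_4_remainder_integral_tendsto:
  assumes lim: "((\<lambda>u. P 4 u - quartic a c d (ln u)) \<longlongrightarrow> 0) at_top"
  shows "(\<lambda>n. \<integral>t. P 4 (real (Suc n) * t) - quartic a c d (ln (real (Suc n) * t)) \<partial>exp_measure) \<longlonglongrightarrow> 0"
proof -
  let ?r = "\<lambda>u. P 4 u - quartic a c d (ln u)"
  obtain B where B: "B \<ge> 0" "\<And>u. u > 0 \<Longrightarrow> \<bar>quartic a c d (ln u)\<bar> \<le> B * (u powr (1/2) + u powr (-1/2))"
    by (rule quartic_ln_bound) blast
  have "\<forall>\<^sub>F u in at_top. \<bar>?r u\<bar> < 1"
    using tendsto_rabs_zero[OF lim] by (rule order_tendstoD) auto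
  then obtain U where U: "\<And>u. u \<ge> U \<Longrightarrow> \<bar>?r u\<bar> < 1"
    unfolding eventually_at_top_linorder by blast
  define V where "V = max U 4"
  have "compact (P 4 ` {4..V})"
    by (intro compact_continuous_image continuous_on_subset[OF continuous_on_P]) auto
  then obtain Q where Q: "\<And>u. u \<in> {4..V} \<Longrightarrow> \<bar>P 4 u\<bar> \<le> Q"
    using compact_imp_bounded[THEN bounded_iff[THEN iffD1]] by (metis image_eqI real_norm_def)
  have "4 \<in> {4..V}" by (simp add: V_def)
  from Q[OF this] have Q0: "Q \<ge> 0" by linarith
  define A where "A = 1 + Q + B * (V powr (1/2) + 1)"
  have A: "\<bar>?r u\<bar> \<le> A * (1 + u powr (-1/2))" if u: "u > 0" for u
  proof (cases "u \<ge> V")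
    case True
    have "1 * 1 \<le> A * (1 + u powr (-1/2))"
      using B(1) Q0 by (intro mult_mono) (auto simp: A_def)
    then show ?thesis using U[of u] True by (simp add: V_def del: P.simps)
  next
    case False
    have "\<bar>P 4 u\<bar> \<le> Q"
      using Q[of u] Q0 P_eq_0[of u 4] False by (cases "u < 4") (auto simp del: P.simps)
    moreover have "\<bar>quartic a c d (ln u)\<bar> \<le> B * (V powr (1/2) + u powr (-1/2))"
      by (rule order_trans[OF B(2)[OF u]]) (use B(1) False u in \<open>auto intro!: mult_left_mono powr_mono2\<close>)
    ultimately have "\<bar>?r u\<bar> \<le> Q + B * (V powr (1/2) + u powr (-1/2))" by linarith
    also have "\<dots> \<le> A * (1 + u powr (-1/2))"
    proof -
      have "0 \<le> (1 + Q + B * V powr (1/2)) * u powr (-1/2)" using B(1) Q0 by simp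
      then show ?thesis using B(1) by (simp add: A_def algebra_simps)
    qed
    finally show ?thesis .
  qed
  have "(\<lambda>n. \<integral>t. ?r (real (Suc n) * t) \<partial>exp_measure) \<longlonglongrightarrow> (\<integral>t. 0 \<partial>exp_measure)"
  proof (rule integral_dominated_convergence)
    \<comment> \<open>The constant 1 is written \<open>t powr 0\<close> so that both summands are
      Gamma integrals.\<close>
    show "integrable exp_measure (\<lambda>t. A * (t powr 0 + t powr (-1/2)))"
      using has_bochner_integral_exp_measure_powr[of 0] has_bochner_integral_exp_measure_powr[of "-1/2"]
      by (auto simp: has_bochner_integral_iff)
    show "AE t in exp_measure. (\<lambda>n. ?r (real (Suc n) * t)) \<longlonglongrightarrow> 0"
      using AE_exp_measure_pos
    proof eventually_elim
      case (elim t)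
      have "filterlim (\<lambda>n. real (Suc n) * t) at_top sequentially"
        using elim by real_asymp
      then show ?case by (rule filterlim_compose[OF lim])
    qed
    show "AE t in exp_measure. norm (?r (real (Suc n) * t)) \<le> A * (t powr 0 + t powr (-1/2))" for n
      using AE_exp_measure_pos
    proof eventually_elim
      case (elim t)
      have "\<bar>?r (real (Suc n) * t)\<bar> \<le> A * (1 + (real (Suc n) * t) powr (-1/2))"
        using elim by (intro A) auto
      also have "\<dots> \<le> A * (1 + t powr (-1/2))"
        using elim B(1) Q0 by (intro mult_left_mono add_mono powr_mono2') (auto simp: A_def)
      finally show ?case using elim by (simp del: P.simps)
    qed
  qed measurable
  then show ?thesis by simp
qed

text \<open>The mean of P_4(Nt) is computed twice, as E(1/N)^4/24 and from the expansion at
  infinity. The l^4 and l^2 terms cancel, the latter because a = -zeta_2/4, leaving an affine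
  function of l that tends to 0 while l tends to infinity; so its constant term is 0.\<close>

lemma P4_formula_at_4: "P 4 4 = P4_formula 4"
proof -
  let ?z = "zeta_val 2"
  define a where "a = - ?z / 4"
  define d where "d = ?z\<^sup>2 / 2 - 19 / 16 * zeta_val 4 + (P 4 4 - P4_formula 4)"
  obtain c where "((\<lambda>u. P 4 u - ((ln u) ^ 4 / 24 - ?z / 4 * (ln u)\<^sup>2 + c * ln u + d)) \<longlongrightarrow> 0) at_top"
    unfolding d_def by (rule P_4_asymptotic) blast
  then have c: "((\<lambda>u. P 4 u - quartic a c d (ln u)) \<longlongrightarrow> 0) at_top"
    by (simp add: a_def del: P.simps)
  obtain E where E: "\<And>s. s > 0 \<Longrightarrow> (E has_real_derivative - (exp (- s) / s)) (at s)"
    and lim: "(E \<longlongrightarrow> 0) at_top"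
    by (rule exponential_integral_exists) blast
  define l where "l = (\<lambda>n. ln (real (Suc n)) - euler_mascheroni)"
  have int: "(\<integral>t. P 4 (real (Suc n) * t) - quartic a c d (ln (real (Suc n) * t)) \<partial>exp_measure)
      = E (1 / real (Suc n)) ^ 4 / 24
        - (ln_moment 4 / 24 + ln_moment 3 * l n / 6 + ?z * ((l n)\<^sup>2 / 4 + a) + quartic a c d (l n))" for n
    using has_bochner_integral_diff[OF has_bochner_integral_exp_measure_P[OF E lim, of "real (Suc n)" 4]
        has_bochner_integral_quartic_ln[of "real (Suc n)" a c d]]
    by (simp add: has_bochner_integral_iff l_def fact_numeral del: P.simps of_nat_Suc)
  have power4: "(\<lambda>n. E (1 / real (Suc n)) ^ 4 - l n ^ 4) \<longlonglongrightarrow> 0"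
    unfolding l_def by (rule exponential_integral_power4_tendsto[OF E lim])
  have "(\<lambda>n. 1 / 24 * (E (1 / real (Suc n)) ^ 4 - l n ^ 4)
      - (E (1 / real (Suc n)) ^ 4 / 24
        - (ln_moment 4 / 24 + ln_moment 3 * l n / 6 + ?z * ((l n)\<^sup>2 / 4 + a) + quartic a c d (l n))))
    \<longlonglongrightarrow> 1 / 24 * 0 - 0"
    by (intro tendsto_diff tendsto_mult tendsto_const power4 P_4_remainder_integral_tendsto[OF c, unfolded int])
  moreover have "1 / 24 * (E (1 / real (Suc n)) ^ 4 - l n ^ 4)
      - (E (1 / real (Suc n)) ^ 4 / 24
        - (ln_moment 4 / 24 + ln_moment 3 * l n / 6 + ?z * ((l n)\<^sup>2 / 4 + a) + quartic a c d (l n)))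
      = (ln_moment 3 / 6 + c) * l n + (ln_moment 4 / 24 + ?z * a + d)" for n
    by (simp add: a_def algebra_simps)
  ultimately have "(\<lambda>n. (ln_moment 3 / 6 + c) * l n + (ln_moment 4 / 24 + ?z * a + d)) \<longlonglongrightarrow> 1 / 24 * 0 - 0"
    by (simp only:)
  then have "(\<lambda>n. (ln_moment 3 / 6 + c) * l n + (ln_moment 4 / 24 + ?z * a + d)) \<longlonglongrightarrow> 0"
    by simp
  moreover have "filterlim l at_top sequentially"
    unfolding l_def by real_asymp
  ultimately have "ln_moment 4 / 24 + ?z * a + d = 0"
    by (intro affine_tendsto_0_imp)
  \<comment> \<open>With K = P_4(4) - \<open>P4_formula 4\<close>, the moments turn the relation
    into 3/8 zeta_2^2 - 15/16 zeta_4 + K = 0, and zeta_4 = 2/5 zeta_2^2 leaves K = 0.\<close>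
  then show ?thesis
    by (simp add: a_def d_def ln_moment_4 zeta_4_eq power2_eq_square del: P.simps)
qed

theorem theorem5:
  fixes u y :: real
  assumes "u \<ge> 4"
    and "y = 1 / (u - 2)"
  shows "P 4 u = P 3 (u - 1) * ln u
           + zeta_val 2 / 4 * (2 * Li 2 (1 - 1 / u) + (ln u) ^ 2)
           - E4 y - H4 y"
  using P_4_minus_formula_const[OF assms(1)] P4_formula_at_4
  by (simp add: P4_formula_def[of u] assms(2) del: P.simps)

end
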